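(* Let $X$ be the set of generators of a finite classical polar space of rank $n$ with parameters $p,e$, let $1\le t\le n$, and let $Y\subseteq X$ be a $t$-Steiner system. Let $(A_0,\dots,A_n)$ be the inner distribution and $(A'_0,\dots,A'_n)$ the dual distribution of $Y$. Then for all $i=0,1,\dots,n-1$, $$A_{n-i}=\sum_{j=i}^{t-1}(-1)^{j-i}p^{\binom{j-i}{2}}\binom{j}{i}_p\binom{n}{j}_p\Big(\prod_{\ell=j}^{t-1}(1+p^{n-\ell+e})-1\Big),$$ and $A'_1=A'_2=\cdots=A'_t=0$.
   Context: The six polar spaces of rank $n$ and their parameters $(p,e)$: ${}^2A_{2n-1}$ (Hermitian form on $\mathbb{F}_{q^2}^{2n}$), $p=q^2$, $e=-1/2$; ${}^2A_{2n}$ (Hermitian form on $\mathbb{F}_{q^2}^{2n+1}$), $p=q^2$, $e=1/2$; $C_n$ (alternating form on $\mathbb{F}_q^{2n}$), $p=q$, $e=0$; $D_n$ (hyperbolic quadratic form on $\mathbb{F}_q^{2n}$), $p=q$, $e=-1$; $B_n$ (parabolic quadratic form on $\mathbb{F}_q^{2n+1}$), $p=q$, $e=0$; ${}^2D_{n+1}$ (elliptic quadratic form on $\mathbb{F}_q^{2n+2}$), $p=q$, $e=1$; $q$ a prime power. Generators are the maximal totally isotropic subspaces (dimension $n$). A $t$-Steiner system is a set of generators such that every totally isotropic $t$-subspace lies in exactly one of them. $\binom{N}{K}_p=\prod_{j=1}^K\frac{p^{N-j+1}-1}{p^j-1}$. Relations $R_i=\{(U,W)\in X\times X:\dim(U\cap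 W)=n-i\}$ form an association scheme; its $P$-numbers (with respect to the standard ordering of primitive idempotents) are $$P_i(k)=v_i\binom{n}{k}_p^{-1}\sum_{\ell=0}^i(-1)^\ell\binom{n-i}{k-\ell}_p\binom{i}{\ell}_p p^{\ell(\ell-i-e-1)},\qquad v_i=p^{\binom{i+1}{2}+ie}\binom{n}{i}_p,$$ and $Q$-numbers $Q_k(i)$ are the unique numbers with $\sum_k P_i(k)Q_k(j)=|X|\delta_{ij}$, where $|X|=\prod_{i=1}^n(1+p^{i+e})$ (equivalently $Q_k(i)=\mu_kP_i(k)/v_i$ with $\mu_k$ the multiplicities). Inner distribution: $A_i=|(Y\times Y)\cap R_i|/|Y|$; dual distribution: $A'_k=\sum_{i=0}^nQ_k(i)A_i$. *)

theory Defs
  imports "HOL-Analysis.Cartesian_Space"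
begin

section \<open>Forms on finite vector spaces\<close>

abbreviation linear_functional :: "('f::field ^ 'm \<Rightarrow> 'f) \<Rightarrow> bool" where
  "linear_functional \<equiv> Vector_Spaces.linear (*s) (*)"

definition bilinear_form :: "('f::field ^ 'm \<Rightarrow> 'f ^ 'm \<Rightarrow> 'f) \<Rightarrow> bool" where
  "bilinear_form b \<longleftrightarrow>
     (\<forall>v. linear_functional (\<lambda>u. b u v)) \<and> (\<forall>u. linear_functional (\<lambda>v. b u v))"

definition alternating_form :: "('f::field ^ 'm \<Rightarrow> 'f ^ 'm \<Rightarrow> 'f) \<Rightarrow> bool" where
  "alternating_form b \<longleftrightarrow> bilinear_form b \<and> (\<forall>v. b v v = 0)"

text \<open>
  Over a field with \<open>q\<^sup>2\<close> elements the map \<open>x \<mapsto> x ^ q\<close> is the automorphism of order two, so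
  semilinearity in the second argument follows from the two conditions below.
\<close>

definition hermitian_form :: "nat \<Rightarrow> ('f::field ^ 'm \<Rightarrow> 'f ^ 'm \<Rightarrow> 'f) \<Rightarrow> bool" where
  "hermitian_form q h \<longleftrightarrow>
     (\<forall>v. linear_functional (\<lambda>u. h u v)) \<and> (\<forall>u v. h v u = h u v ^ q)"

definition nondegenerate :: "('f::field ^ 'm \<Rightarrow> 'f ^ 'm \<Rightarrow> 'f) \<Rightarrow> bool" where
  "nondegenerate b \<longleftrightarrow> (\<forall>u. (\<forall>v. b u v = 0) \<longrightarrow> u = 0)"

definition polarization :: "('f::field ^ 'm \<Rightarrow> 'f) \<Rightarrow> 'f ^ 'm \<Rightarrow> 'f ^ 'm \<Rightarrow> 'f" where
  "polarization Q u v = Q (u + v) - Q u - Q v"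

definition quadratic_form :: "('f::field ^ 'm \<Rightarrow> 'f) \<Rightarrow> bool" where
  "quadratic_form Q \<longleftrightarrow> (\<forall>c v. Q (c *s v) = c\<^sup>2 * Q v) \<and> bilinear_form (polarization Q)"

text \<open>
  In characteristic two and odd dimension the polarization of a nondegenerate quadratic form has
  a one-dimensional radical, so only singular vectors of the radical have to vanish.
\<close>

definition nondegenerate_quadratic :: "('f::field ^ 'm \<Rightarrow> 'f) \<Rightarrow> bool" where
  "nondegenerate_quadratic Q \<longleftrightarrow>
     (\<forall>u. Q u = 0 \<and> (\<forall>v. polarization Q u v = 0) \<longrightarrow> u = 0)"

definition isotropic_subspaces :: "('f::field ^ 'm \<Rightarrow> 'f ^ 'm \<Rightarrow> 'f) \<Rightarrow> ('f ^ 'm) set set" where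
  "isotropic_subspaces b = {U. vec.subspace U \<and> (\<forall>u\<in>U. \<forall>v\<in>U. b u v = 0)}"

definition singular_subspaces :: "('f::field ^ 'm \<Rightarrow> 'f) \<Rightarrow> ('f ^ 'm) set set" where
  "singular_subspaces Q = {U. vec.subspace U \<and> (\<forall>u\<in>U. Q u = 0)}"

definition witt_index :: "('f::field ^ 'm \<Rightarrow> 'f) \<Rightarrow> nat" where
  "witt_index Q = Max (vec.dim ` singular_subspaces Q)"

definition hyperbolic :: "nat \<Rightarrow> ('f::field ^ 'm \<Rightarrow> 'f) \<Rightarrow> bool" where
  "hyperbolic n Q \<longleftrightarrow> CARD('m) = 2 * n \<and>
     quadratic_form Q \<and> nondegenerate_quadratic Q \<and> witt_index Q = n"

definition parabolic :: "nat \<Rightarrow> ('f::field ^ 'm \<Rightarrow> 'f) \<Rightarrow> bool" where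
  "parabolic n Q \<longleftrightarrow> CARD('m) = 2 * n + 1 \<and>
     quadratic_form Q \<and> nondegenerate_quadratic Q"

definition elliptic :: "nat \<Rightarrow> ('f::field ^ 'm \<Rightarrow> 'f) \<Rightarrow> bool" where
  "elliptic n Q \<longleftrightarrow> CARD('m) = 2 * n + 2 \<and>
     quadratic_form Q \<and> nondegenerate_quadratic Q \<and> witt_index Q = n"


section \<open>Finite classical polar spaces\<close>

text \<open>
  \<open>classical_polar_space n p e S\<close>: \<open>S\<close> is the set of all totally isotropic subspaces (including
  the zero subspace) of one of the six classical polar spaces of rank \<open>n\<close> with parameters
  \<open>p\<close>, \<open>e\<close>. That \<open>q\<close> is a prime power is forced by the cardinality of the field.
\<close>

inductive classical_polar_space ::
  "nat \<Rightarrow> real \<Rightarrow> real \<Rightarrow> ('f::{field,finite} ^ 'm) set set \<Rightarrow> bool"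
where
  polar_2A_odd:
    "CARD('f) = q\<^sup>2 \<Longrightarrow> CARD('m) = 2 * n \<Longrightarrow>
     hermitian_form q h \<Longrightarrow> nondegenerate h \<Longrightarrow>
     classical_polar_space n ((real q)\<^sup>2) (- 1 / 2)
       (isotropic_subspaces h :: ('f::{field,finite} ^ 'm) set set)"
| polar_2A_even:
    "CARD('f) = q\<^sup>2 \<Longrightarrow> CARD('m) = 2 * n + 1 \<Longrightarrow>
     hermitian_form q h \<Longrightarrow> nondegenerate h \<Longrightarrow>
     classical_polar_space n ((real q)\<^sup>2) (1 / 2)
       (isotropic_subspaces h :: ('f::{field,finite} ^ 'm) set set)"
| polar_C:
    "CARD('f) = q \<Longrightarrow> CARD('m) = 2 * n \<Longrightarrow>
     alternating_form b \<Longrightarrow> nondegenerate b \<Longrightarrow>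
     classical_polar_space n (real q) 0
       (isotropic_subspaces b :: ('f::{field,finite} ^ 'm) set set)"
| polar_D:
    "CARD('f) = q \<Longrightarrow> hyperbolic n Q \<Longrightarrow>
     classical_polar_space n (real q) (- 1)
       (singular_subspaces Q :: ('f::{field,finite} ^ 'm) set set)"
| polar_B:
    "CARD('f) = q \<Longrightarrow> parabolic n Q \<Longrightarrow>
     classical_polar_space n (real q) 0
       (singular_subspaces Q :: ('f::{field,finite} ^ 'm) set set)"
| polar_2D:
    "CARD('f) = q \<Longrightarrow> elliptic n Q \<Longrightarrow>
     classical_polar_space n (real q) 1
       (singular_subspaces Q :: ('f::{field,finite} ^ 'm) set set)"

definition generators :: "('f::field ^ 'm) set set \<Rightarrow> ('f ^ 'm) set set" where
  "generators S = {U \<in> S. \<forall>W\<in>S. U \<subseteq> W \<longrightarrow> W = U}"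

definition steiner_system ::
  "('f::field ^ 'm) set set \<Rightarrow> nat \<Rightarrow> ('f ^ 'm) set set \<Rightarrow> bool" where
  "steiner_system S t Y \<longleftrightarrow>
     Y \<subseteq> generators S \<and> (\<forall>T\<in>S. vec.dim T = t \<longrightarrow> (\<exists>!U. U \<in> Y \<and> T \<subseteq> U))"


section \<open>The association scheme on generators\<close>

text \<open>
  The product formula is only meant for nonnegative lower argument; for negative lower argument
  (which occurs in the \<open>P\<close>-numbers) the coefficient is zero.
\<close>

definition gauss_binomial :: "real \<Rightarrow> int \<Rightarrow> int \<Rightarrow> real" where
  "gauss_binomial p N K =
     (if K < 0 then 0 else \<Prod>j=1..K. (p powi (N - j + 1) - 1) / (p powi j - 1))"

definition scheme_relation ::
  "nat \<Rightarrow> ('f::field ^ 'm) set set \<Rightarrow> nat \<Rightarrow> (('f ^ 'm) set \<times> ('f ^ 'm) set) set" where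
  "scheme_relation n X i = {(U, W) \<in> X \<times> X. vec.dim (U \<inter> W) = n - i}"

definition valency :: "real \<Rightarrow> real \<Rightarrow> nat \<Rightarrow> nat \<Rightarrow> real" where
  "valency p e n i = p powr (real ((i + 1) choose 2) + real i * e) * gauss_binomial p n i"

definition P_number :: "real \<Rightarrow> real \<Rightarrow> nat \<Rightarrow> nat \<Rightarrow> nat \<Rightarrow> real" where
  "P_number p e n i k =
     valency p e n i * inverse (gauss_binomial p n k) *
     (\<Sum>l=0..i. (-1) ^ l * gauss_binomial p (int n - int i) (int k - int l) *
        gauss_binomial p i l * p powr (real l * (real l - real i - e - 1)))"

text \<open>
  \<open>N\<close> is the number of generators. The conditions determine \<open>Q k j\<close> for \<open>k, j \<le> n\<close>; the last
  conjunct only makes the function itself unique.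
\<close>

definition Q_number :: "real \<Rightarrow> real \<Rightarrow> nat \<Rightarrow> nat \<Rightarrow> nat \<Rightarrow> nat \<Rightarrow> real" where
  "Q_number p e n N = (THE Q.
     (\<forall>i\<le>n. \<forall>j\<le>n. (\<Sum>k=0..n. P_number p e n i k * Q k j) = (if i = j then real N else 0)) \<and>
     (\<forall>k j. n < k \<or> n < j \<longrightarrow> Q k j = 0))"

definition inner_distribution ::
  "nat \<Rightarrow> ('f::field ^ 'm) set set \<Rightarrow> ('f ^ 'm) set set \<Rightarrow> nat \<Rightarrow> real" where
  "inner_distribution n X Y i =
     real (card ((Y \<times> Y) \<inter> scheme_relation n X i)) / real (card Y)"

definition dual_distribution ::
  "real \<Rightarrow> real \<Rightarrow> nat \<Rightarrow> ('f::field ^ 'm) set set \<Rightarrow> ('f ^ 'm) set set \<Rightarrow> nat \<Rightarrow> real" where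
  "dual_distribution p e n X Y k =
     (\<Sum>i=0..n. Q_number p e n (card X) k i * inner_distribution n X Y i)"

end

theory Submission
  imports Defs "HOL-Computational_Algebra.Polynomial" "HOL-Algebra.Sylow"
begin

text \<open>
  Geometry. If \<open>u\<close> is singular, every line in direction \<open>u\<close> outside the hyperplane perpendicular
  to \<open>u\<close> carries the same number of singular vectors. Adding the vectors of a totally isotropic
  subspace \<open>T\<close> one at a time thus determines the number of singular vectors perpendicular to \<open>T\<close>
  from \<open>dim T\<close> alone. Hence all generators have the same dimension, and every totally isotropic
  \<open>j\<close>-space lies in the same number of totally isotropic \<open>(j+1)\<close>-spaces. By downward double counting
  every totally isotropic \<open>j\<close>-space with \<open>j \<le> t\<close> lies in \<open>\<Prod>l=j..<t. 1 + p^(n-l+e)\<close> blocks, which gives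
  all the sums \<open>\<Sum>i. [n-i, j] * A i\<close> of the inner distribution; \<open>q\<close>-binomial inversion yields the
  first claim.

  Algebra. By the \<open>q\<close>-binomial theorem \<open>P_i(k)\<close> is the coefficient of \<open>z^i\<close> in
  \<open>(\<Prod>a<k. 1 - p^a z) * (\<Prod>b=1..n-k. 1 + p^(b+e) z)\<close>. These polynomials span all polynomials of
  degree at most \<open>n\<close>, so the \<open>Q\<close>-numbers exist, and their values at \<open>z = p^(-a)\<close> form a triangular
  matrix. The sums known from the geometry say that the inner distribution agrees with a multiple of
  \<open>P_i(0)\<close> at the points \<open>p^(-a)\<close> with \<open>a \<le> t\<close>, so triangularity forces \<open>A'\<^sub>1 = \<dots> = A'\<^sub>t = 0\<close>.
\<close>

section \<open>Gaussian binomial coefficients\<close>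

text \<open>The q-factorial without its normalising powers of \<open>p - 1\<close>; these cancel in
  the quotients that express Gaussian binomials.\<close>

definition q_factorial :: "real \<Rightarrow> nat \<Rightarrow> real" where
  "q_factorial p n = (\<Prod>j=1..n. p ^ j - 1)"

lemma q_factorial_Suc: "q_factorial p (Suc n) = q_factorial p n * (p ^ Suc n - 1)"
  by (simp add: q_factorial_def)

lemma q_factorial_pos: "1 < p \<Longrightarrow> 0 < q_factorial p n"
  unfolding q_factorial_def by (intro prod_pos) (auto intro: one_less_power)

lemma power_Suc_minus_1_pos: "1 < p \<Longrightarrow> (0::real) < p ^ Suc k - 1"
  using one_less_power[of p "Suc k"] by (simp del: power_Suc)

lemma gauss_binomial_0 [simp]: "gauss_binomial p N 0 = 1"
  by (simp add: gauss_binomial_def)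

lemma gauss_binomial_Suc:
  "gauss_binomial p N (int (Suc k)) =
     gauss_binomial p N (int k) * ((p powi (N - int k) - 1) / (p ^ Suc k - 1))"
proof -
  have "{1..int (Suc k)} = insert (int (Suc k)) {1..int k}" by auto
  moreover have "p powi (int (Suc k)) = p ^ Suc k" by (rule power_int_of_nat)
  ultimately show ?thesis by (simp add: gauss_binomial_def mult.commute)
qed

text \<open>The factor with index \<open>n + 1\<close> has numerator \<open>p powi 0 - 1\<close>.
  Sums over the lower index may therefore be extended or cut freely.\<close>

lemma gauss_binomial_eq_0: "n < k \<Longrightarrow> gauss_binomial p (int n) (int k) = 0"
  unfolding gauss_binomial_def
  by (auto intro!: prod_zero bexI[of _ "int n + 1"])

lemma gauss_binomial_fact:
  assumes p: "1 < p" and "k \<le> n"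
  shows "gauss_binomial p (int n) (int k) =
           q_factorial p n / (q_factorial p k * q_factorial p (n - k))"
  using \<open>k \<le> n\<close>
proof (induction k)
  case 0
  have "q_factorial p 0 = 1" by (simp add: q_factorial_def)
  then show ?case using q_factorial_pos[OF p, of n] by simp
next
  case (Suc k)
  define m where "m = n - Suc k"
  have n: "n - k = Suc m" "n - Suc k = m" using Suc.prems by (auto simp: m_def)
  have "int n - int k = int (Suc m)" using Suc.prems by (auto simp: m_def)
  then have "p powi (int n - int k) = p ^ Suc m" by (metis power_int_of_nat)
  moreover have "p ^ Suc m - 1 > 0" "p ^ Suc k - 1 > 0"
      using power_Suc_minus_1_pos[OF p] by blast+
  ultimately show ?case
    using Suc q_factorial_pos[OF p, of k] q_factorial_pos[OF p, of m]
    unfolding gauss_binomial_Suc n q_factorial_Suc by (simp add: divide_simps mult_ac del: power_Suc)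
qed

lemma gauss_binomial_self: "1 < p \<Longrightarrow> gauss_binomial p (int n) (int n) = 1"
  using q_factorial_pos[of p n] by (simp add: gauss_binomial_fact q_factorial_def[of p 0])

lemma gauss_binomial_pos: "1 < p \<Longrightarrow> k \<le> n \<Longrightarrow> gauss_binomial p (int n) (int k) > 0"
  by (simp add: gauss_binomial_fact q_factorial_pos)

text \<open>This expresses \<open>p ^ n\<close> times a Gaussian binomial through the ones with
  lower index \<open>k\<close> and \<open>Suc k\<close>, which later turns binomial sums into power
  sums. Without division it also covers \<open>n < k\<close>, where both sides vanish.\<close>

lemma gauss_binomial_absorb:
  assumes p: "1 < p"
  shows "p ^ k * gauss_binomial p (int n) (int (Suc k)) * (p ^ Suc k - 1) =
         (p ^ n - p ^ k) * gauss_binomial p (int n) (int k)"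
proof -
  consider "n < k" | "k \<le> n" by linarith
  then show ?thesis
  proof cases
    case 1
    then show ?thesis by (simp add: gauss_binomial_eq_0 del: of_nat_Suc)
  next
    case 2
    have "p powi (int n - int k) = p ^ (n - k)" using 2 by (metis of_nat_diff power_int_of_nat)
    moreover have "p ^ n = p ^ k * p ^ (n - k)" using 2 by (simp flip: power_add)
    moreover have "p ^ Suc k - 1 > 0" using power_Suc_minus_1_pos[OF p] .
    ultimately show ?thesis unfolding gauss_binomial_Suc by (simp add: field_simps del: power_Suc)
  qed
qed

text \<open>Of the two q-Pascal rules, this one fits the q-binomial product, whose last factor
  carries \<open>p ^ n\<close>. Where \<open>n - k\<close> is truncated, the binomial next to it is
  0.\<close>

lemma gauss_binomial_Suc_Suc:
  assumes p: "1 < p"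
  shows "gauss_binomial p (int (Suc n)) (int (Suc k)) =
         gauss_binomial p (int n) (int (Suc k)) + p ^ (n - k) * gauss_binomial p (int n) (int k)"
proof -
  consider "n < k" | "n = k" | "k < n" by linarith
  then show ?thesis
  proof cases
    case 1
    then show ?thesis by (simp add: gauss_binomial_eq_0 del: of_nat_Suc)
  next
    case 2
    then show ?thesis using p by (simp add: gauss_binomial_eq_0 gauss_binomial_self del: of_nat_Suc)
  next
    case 3
    define m where "m = n - Suc k"
    have n: "n = Suc (k + m)" using 3 by (simp add: m_def)
    have 1: "Suc n - Suc k = Suc m" "n - Suc k = m" "n - k = Suc m" "Suc k \<le> n" "k \<le> n" "Suc k \<le> Suc n"
      using n by auto
    have pos: "p ^ Suc m - 1 > 0" "p ^ Suc k - 1 > 0"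
      using power_Suc_minus_1_pos[OF p] by blast+
    have eq: "p ^ Suc n = p ^ Suc k * p ^ Suc m" by (simp add: n power_add)
    show ?thesis
      using q_factorial_pos[OF p, of k] q_factorial_pos[OF p, of m] q_factorial_pos[OF p, of n] pos
      unfolding gauss_binomial_fact[OF p 1(4)] gauss_binomial_fact[OF p 1(5)]
        gauss_binomial_fact[OF p 1(6)] 1(1-3) q_factorial_Suc eq
      by (simp add: divide_simps del: power_Suc) (simp add: algebra_simps del: power_Suc)
  qed
qed

lemma gauss_binomial_rec:
  assumes p: "1 < p" and "k \<le> n"
  shows "gauss_binomial p (int (Suc n)) (int (Suc k)) * (p ^ Suc k - 1) =
         (p ^ Suc n - 1) * gauss_binomial p (int n) (int k)"
  using assms less_imp_neq[OF power_Suc_minus_1_pos[OF p, of k]] q_factorial_pos[OF p, of k]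
  by (simp add: gauss_binomial_fact q_factorial_Suc del: of_nat_Suc power_Suc)

lemma gauss_binomial_mult:
  assumes p: "1 < p" and "i \<le> j" "j \<le> m"
  shows "gauss_binomial p (int m) (int j) * gauss_binomial p (int j) (int i) =
         gauss_binomial p (int m) (int i) * gauss_binomial p (int (m - i)) (int (j - i))"
proof -
  have "m - i - (j - i) = m - j" using assms by auto
  then show ?thesis
    using assms q_factorial_pos[OF p, of j] q_factorial_pos[OF p, of "m - i"]
    by (simp add: gauss_binomial_fact del: of_nat_diff)
qed

text \<open>Both sides are the q-multinomial with parts \<open>l\<close>, \<open>i - l\<close>,
  \<open>k - l\<close> and \<open>n - k - (i - l)\<close>, and both are 0 if the third or fourth
  part is negative.\<close>

lemma gauss_binomial_trinomial:
  assumes p: "1 < p" and "l \<le> i" "i \<le> n" "k \<le> n"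
  shows "gauss_binomial p (int n) (int i) * gauss_binomial p (int n - int i) (int k - int l) *
           gauss_binomial p (int i) (int l) =
         gauss_binomial p (int n) (int k) * gauss_binomial p (int k) (int l) *
           gauss_binomial p (int (n - k)) (int (i - l))"
proof -
  consider "k < l" | "l \<le> k" "n - k < i - l" | "l \<le> k" "i - l \<le> n - k" by linarith
  then show ?thesis
  proof cases
    case 1
    then show ?thesis by (simp add: gauss_binomial_eq_0) (simp add: gauss_binomial_def)
  next
    case 2
    have "int n - int i = int (n - i)" "int k - int l = int (k - l)" "n - i < k - l"
      using 2 assms by auto
    then have "gauss_binomial p (int n - int i) (int k - int l) = 0"
      by (metis gauss_binomial_eq_0)
    then show ?thesis using gauss_binomial_eq_0[OF 2(2)] by simp
  next
    case 3
    have 1: "int n - int i = int (n - i)" "int k - int l = int (k - l)" using 3 assms by auto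
    have 2: "n - i - (k - l) = n - k - (i - l)" "k - l \<le> n - i" using 3 assms by auto
    show ?thesis unfolding 1
      using 2 3 assms q_factorial_pos[OF p, of k] q_factorial_pos[OF p, of "n - k"]
        q_factorial_pos[OF p, of i] q_factorial_pos[OF p, of "n - i"]
      by (simp add: gauss_binomial_fact del: of_nat_diff)
  qed
qed

section \<open>The q-binomial theorem and q-binomial inversion\<close>

text \<open>Splitting off the factor with \<open>b = m\<close> gives a recursion for the
  coefficients that is exactly \<open>gauss_binomial_Suc_Suc\<close>.\<close>

lemma coeff_q_binomial:
  assumes p: "1 < p"
  shows "coeff (\<Prod>b<m. [:1, p ^ b * y:]) i =
         p ^ (i choose 2) * y ^ i * gauss_binomial p (int m) (int i)"
proof (induction m arbitrary: i)
  case 0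
  then show ?case
    using gauss_binomial_eq_0[of 0 i p] by (cases i) (simp_all add: numeral_2_eq_2)
next
  case (Suc m)
  show ?case
  proof (cases i)
    case 0
    then show ?thesis using Suc[of 0] by (simp add: binomial_eq_0)
  next
    case (Suc j)
    have c: "Suc j choose 2 = (j choose 2) + j" by (simp add: numeral_2_eq_2)
    have "coeff (\<Prod>b<Suc m. [:1, p ^ b * y:]) (Suc j) =
        coeff (\<Prod>b<m. [:1, p ^ b * y:]) (Suc j) + p ^ m * y * coeff (\<Prod>b<m. [:1, p ^ b * y:]) j"
      by (simp add: mult.commute[of _ "[:1, _:]"])
    also have "\<dots> = p ^ (Suc j choose 2) * y ^ Suc j * gauss_binomial p (int m) (int (Suc j)) +
        p ^ m * y * (p ^ (j choose 2) * y ^ j * gauss_binomial p (int m) (int j))"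
      unfolding Suc.IH ..
    also have "p ^ m * y * (p ^ (j choose 2) * y ^ j * gauss_binomial p (int m) (int j)) =
        p ^ (Suc j choose 2) * y ^ Suc j * (p ^ (m - j) * gauss_binomial p (int m) (int j))"
    proof (cases "j \<le> m")
      case True
      then have "p ^ m = p ^ j * p ^ (m - j)" by (simp flip: power_add)
      then show ?thesis by (simp add: c power_add)
    qed (simp add: gauss_binomial_eq_0)
    finally show ?thesis unfolding Suc gauss_binomial_Suc_Suc[OF p] by (simp only: distrib_left)
  qed
qed

lemma poly_eq_sum_coeff:
  fixes z :: "'a :: comm_semiring_1"
  assumes "degree P \<le> n"
  shows "poly P z = (\<Sum>i\<le>n. coeff P i * z ^ i)"
  unfolding poly_altdef using assms
  by (intro sum.mono_neutral_left) (auto simp: coeff_eq_0)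

lemma degree_prod_linear_le: "degree (\<Prod>b<m. [:1, f b:]) \<le> m"
proof -
  have "degree (\<Prod>b<m. [:1, f b:]) \<le> (\<Sum>b<m. degree [:1, f b:])"
    by (rule degree_prod_sum_le[unfolded o_def]) simp
  also have "\<dots> \<le> (\<Sum>b<m. 1)" by (intro sum_mono) simp
  finally show ?thesis by simp
qed

text \<open>\<open>gauss_binomial_mult\<close> pulls the binomial of \<open>m\<close> over
  \<open>i\<close> out of the sum. What remains is the q-binomial product with \<open>y = -1\<close>
  evaluated at 1: its factor with \<open>b = 0\<close> is 0, and the product is empty only for
  \<open>m = i\<close>.\<close>

lemma gauss_inversion:
  assumes p: "1 < p" and "m \<le> N"
  shows "(\<Sum>j=i..N. (-1) ^ (j - i) * p ^ ((j - i) choose 2) * gauss_binomial p (int j) (int i) *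
            gauss_binomial p (int m) (int j)) = (if m = i then 1 else 0)"
proof -
  consider "m < i" | "i \<le> m" by linarith
  then show ?thesis
  proof cases
    case 1
    then show ?thesis by (auto intro!: sum.neutral simp: gauss_binomial_eq_0)
  next
    case 2
    have "(\<Sum>j=i..N. (-1) ^ (j - i) * p ^ ((j - i) choose 2) * gauss_binomial p (int j) (int i) *
            gauss_binomial p (int m) (int j)) =
        (\<Sum>j=i..m. (-1) ^ (j - i) * p ^ ((j - i) choose 2) * gauss_binomial p (int j) (int i) *
            gauss_binomial p (int m) (int j))"
      using assms by (intro sum.mono_neutral_right) (auto simp: gauss_binomial_eq_0)
    also have "\<dots> = (\<Sum>j=i..m. gauss_binomial p (int m) (int i) *
        coeff (\<Prod>b<m - i. [:1, p ^ b * (-1):]) (j - i))"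
      unfolding coeff_q_binomial[OF p]
    proof (intro sum.cong refl, goal_cases)
      case (1 j)
      with gauss_binomial_mult[OF p, of i j m] show ?case by (simp add: algebra_simps)
    qed
    also have "\<dots> = gauss_binomial p (int m) (int i) *
        (\<Sum>r\<le>m - i. coeff (\<Prod>b<m - i. [:1, p ^ b * (-1):]) r)"
      unfolding sum_distrib_left[symmetric]
      using 2 by (intro arg_cong2[where f="(*)"] refl sum.reindex_bij_witness[of _ "\<lambda>r. r + i" "\<lambda>j. j - i"]) auto
    also have "(\<Sum>r\<le>m - i. coeff (\<Prod>b<m - i. [:1, p ^ b * (-1):]) r) =
        poly (\<Prod>b<m - i. [:1, p ^ b * (-1):]) 1"
      by (simp add: poly_eq_sum_coeff[OF degree_prod_linear_le])
    also have "\<dots> = (if m = i then 1 else 0)"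
      using 2 by (auto simp: poly_prod intro!: bexI[of _ 0] prod_zero)
    finally show ?thesis using gauss_binomial_self[OF p, of i] by (auto split: if_splits)
  qed
qed

section \<open>The \<open>P\<close>- and \<open>Q\<close>-numbers\<close>

text \<open>The generating polynomial of \<open>P_i(k)\<close> over \<open>i\<close>, with
  \<open>x\<close> standing for \<open>p^e\<close>. Both products have the shape of
  \<open>coeff_q_binomial\<close>, for \<open>y = -1\<close> and for
  \<open>y = p * x\<close>.\<close>

definition P_poly :: "real \<Rightarrow> real \<Rightarrow> nat \<Rightarrow> nat \<Rightarrow> real poly" where
  "P_poly p x n k = (\<Prod>b<k. [:1, p ^ b * (-1):]) * (\<Prod>b<n - k. [:1, p ^ b * (p * x):])"

lemma real_choose_two: "real (m choose 2) = real m * (real m - 1) / 2"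
  by (induction m) (simp_all add: numeral_2_eq_2 field_simps)

text \<open>The summand with index \<open>l\<close> is the coefficient of degree \<open>l\<close> in
  the first product times that of degree \<open>i - l\<close> in the second, so the defining sum is
  a convolution.\<close>

lemma P_number_eq_coeff:
  assumes p: "1 < p" and "i \<le> n" "k \<le> n"
  shows "P_number p e n i k = coeff (P_poly p (p powr e) n k) i"
proof -
  have "valency p e n i * inverse (gauss_binomial p n k) *
          ((-1) ^ l * gauss_binomial p (int n - int i) (int k - int l) *
           gauss_binomial p i l * p powr (real l * (real l - real i - e - 1))) =
        (p ^ (l choose 2) * (-1) ^ l * gauss_binomial p k l) *
        (p ^ ((i - l) choose 2) * (p * p powr e) ^ (i - l) * gauss_binomial p (int (n - k)) (int (i - l)))"
    if "l \<le> i" for l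
  proof -
    define r where "r = i - l"
    have i: "i = l + r" using that by (simp add: r_def)
    have nk: "gauss_binomial p n k \<noteq> 0" using gauss_binomial_pos[OF p \<open>k \<le> n\<close>] by simp
    define g h where "g = gauss_binomial p n k" and "h = p powr (real l * (real l - real i - e - 1))"
    define w where "w = p powr (real ((i + 1) choose 2) + real i * e)"
    \<comment> \<open>With \<open>i = l + r\<close> the mixed terms \<open>l * r\<close> cancel, so
      the power of \<open>p\<close> separates into a part in \<open>l\<close> and a part in
      \<open>r\<close>.\<close>
    have "(real ((i + 1) choose 2) + real i * e) + real l * (real l - real i - e - 1) =
        real (l choose 2) + real (r choose 2) + real r + real r * e"
      unfolding real_choose_two i by (simp add: field_simps)
    then have "w * h = p powr (real (l choose 2) + real (r choose 2) + real r + real r * e)"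
      by (simp only: w_def h_def powr_add[symmetric])
    moreover have "p powr (real r * e) = (p powr e) ^ r" using p by (simp add: powr_power mult.commute)
    ultimately have pw: "w * h = p ^ (l choose 2) * p ^ ((i - l) choose 2) * (p * p powr e) ^ (i - l)"
      using p by (simp add: powr_add powr_realpow power_mult_distrib i)
    \<comment> \<open>Both regroupings are stated for arbitrary reals so that they can serve as
      rewrite rules around \<open>pw\<close> and the trinomial identity.\<close>
    have reorder: "(w * a) * inverse g * (d * b * c * h) = (w * h) * (d * inverse g * (a * b * c))"
      for a b c d :: real by (simp only: mult_ac)
    have cancel: "(a * b * c) * (d * inverse g * (g * a' * b')) = a * d * a' * (b * c * b')"
      for a b c d a' b' :: real using nk[folded g_def] by simp
    show ?thesis
      unfolding valency_def w_def[symmetric] h_def[symmetric] g_def[symmetric] reorder pw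
        gauss_binomial_trinomial[OF p that assms(2,3)] unfolding g_def[symmetric] cancel ..
  qed
  then show ?thesis
    unfolding P_number_def P_poly_def coeff_mult coeff_q_binomial[OF p] sum_distrib_left
      atMost_atLeast0 by (intro sum.cong refl) (simp only: atLeastAtMost_iff)
qed

section \<open>Spanning and triangularity of the generating polynomials\<close>

lemma P_poly_Suc:
  assumes "k \<le> n"
  shows "P_poly p x (Suc n) k = P_poly p x n k * [:1, p ^ (n - k) * (p * x):]"
    and "P_poly p x (Suc n) (Suc k) = P_poly p x n k * [:1, - (p ^ k):]"
  using assms by (simp_all add: P_poly_def Suc_diff_le mult.assoc mult.left_commute mult.commute
      del: mult_pCons_left mult_pCons_right)

lemma degree_P_poly: "k \<le> n \<Longrightarrow> degree (P_poly p x n k) \<le> n"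
  unfolding P_poly_def
  using degree_mult_le[of "\<Prod>b<k. [:1, p ^ b * (-1):]" "\<Prod>b<n - k. [:1, p ^ b * (p * x):]"]
    degree_prod_linear_le[of "\<lambda>b. p ^ b * (-1)" k] degree_prod_linear_le[of "\<lambda>b. p ^ b * (p * x)" "n - k"]
  by linarith

text \<open>Padding \<open>u\<close> with 0 at the top and the shifted \<open>w\<close> with 0 at
  the bottom gives both sums the range up to \<open>Suc n\<close>.\<close>

lemma combine_shifted_sums:
  fixes G :: "nat \<Rightarrow> 'a::comm_semiring_0 poly"
  shows "\<exists>c. (\<Sum>k\<le>n. smult (u k) (G k)) + (\<Sum>k\<le>n. smult (w k) (G (Suc k))) =
         (\<Sum>k\<le>Suc n. smult (c k) (G k))"
proof
  define u' w' where "u' k = (if k \<le> n then u k else 0)" and "w' k = (case k of 0 \<Rightarrow> 0 | Suc m \<Rightarrow> w m)" for k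
  have "(\<Sum>k\<le>n. smult (u k) (G k)) = (\<Sum>k\<le>Suc n. smult (u' k) (G k))"
    by (simp add: u'_def)
  moreover have "(\<Sum>k\<le>n. smult (w k) (G (Suc k))) = (\<Sum>k\<le>Suc n. smult (w' k) (G k))"
    unfolding sum.atMost_Suc_shift by (simp add: w'_def)
  ultimately show "(\<Sum>k\<le>n. smult (u k) (G k)) + (\<Sum>k\<le>n. smult (w k) (G (Suc k))) =
      (\<Sum>k\<le>Suc n. smult (u' k + w' k) (G k))"
    by (simp add: smult_add_left sum.distrib add_ac)
qed

text \<open>The two factors relating rank \<open>n\<close> to rank \<open>n + 1\<close> are linearly independent, so their
  combinations contain both \<open>1\<close> and the indeterminate.\<close>

lemma monom_in_span_P_poly:
  assumes p: "1 < p" and x: "0 < x" and "j \<le> n"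
  shows "\<exists>c. monom 1 j = (\<Sum>k\<le>n. smult (c k) (P_poly p x n k))"
  using \<open>j \<le> n\<close>
proof (induction n arbitrary: j)
  case 0
  then show ?case by (intro exI[of _ "\<lambda>_. 1"]) (simp add: P_poly_def)
next
  case (Suc n)
  let ?G = "P_poly p x (Suc n)"
  \<comment> \<open>\<open>\<alpha> k\<close> and \<open>- (p ^ k)\<close> are the slopes of the two
    new linear factors. Their difference \<open>D k\<close> is positive, hence the factors are
    independent.\<close>
  define \<alpha> D where "\<alpha> k = p ^ (n - k) * (p * x)" and "D k = \<alpha> k + p ^ k" for k
  have D: "D k > 0" for k using p x by (simp add: D_def \<alpha>_def add_pos_pos)
  have 1: "P_poly p x n k = smult (p ^ k / D k) (?G k) + smult (\<alpha> k / D k) (?G (Suc k))"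
    if "k \<le> n" for k
  proof -
    have "smult (p ^ k) (?G k) + smult (\<alpha> k) (?G (Suc k)) =
        P_poly p x n k * (smult (p ^ k) [:1, \<alpha> k:] + smult (\<alpha> k) [:1, - (p ^ k):])"
      unfolding P_poly_Suc[OF that] \<alpha>_def[symmetric] by (simp only: distrib_left mult_smult_right)
    also have "smult (p ^ k) [:1, \<alpha> k:] + smult (\<alpha> k) [:1, - (p ^ k):] = [:D k:]"
      by (simp add: D_def algebra_simps)
    finally have "smult (1 / D k) (smult (p ^ k) (?G k) + smult (\<alpha> k) (?G (Suc k))) = P_poly p x n k"
      using D[of k] by simp
    then show ?thesis by (simp add: smult_add_right)
  qed
  have 2: "pCons 0 (P_poly p x n k) = smult (1 / D k) (?G k) + smult (- 1 / D k) (?G (Suc k))"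
    if "k \<le> n" for k
  proof -
    have "?G k - ?G (Suc k) = P_poly p x n k * ([:1, \<alpha> k:] - [:1, - (p ^ k):])"
      unfolding P_poly_Suc[OF that] \<alpha>_def[symmetric] by (simp only: right_diff_distrib)
    also have "[:1, \<alpha> k:] - [:1, - (p ^ k):] = [:0, D k:]" by (simp add: D_def)
    finally have "smult (1 / D k) (?G k - ?G (Suc k)) = pCons 0 (P_poly p x n k)"
      using D[of k] by simp
    then show ?thesis by (simp add: smult_diff_right)
  qed
  show ?case
  proof (cases "j \<le> n")
    case True
    from Suc.IH[OF this] obtain c where "monom 1 j = (\<Sum>k\<le>n. smult (c k) (P_poly p x n k))" ..
    also have "\<dots> = (\<Sum>k\<le>n. smult (c k * (p ^ k / D k)) (?G k)) + (\<Sum>k\<le>n. smult (c k * (\<alpha> k / D k)) (?G (Suc k)))"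
      unfolding sum.distrib[symmetric] by (intro sum.cong refl) (simp add: 1 smult_add_right)
    finally show ?thesis
      using combine_shifted_sums[of "\<lambda>k. c k * (p ^ k / D k)" ?G n "\<lambda>k. c k * (\<alpha> k / D k)"] by simp
  next
    case False
    then have j: "j = Suc n" using Suc.prems by simp
    \<comment> \<open>The top monomial is out of reach of the induction hypothesis, so
      \<open>monom 1 n\<close> is multiplied by the indeterminate and expanded with fact
      \<open>2\<close>.\<close>
    from Suc.IH[OF order_refl] obtain c where
      "monom 1 n = (\<Sum>k\<le>n. smult (c k) (P_poly p x n k))" ..
    then have "monom 1 j = [:0, 1:] * (\<Sum>k\<le>n. smult (c k) (P_poly p x n k))"
      by (simp add: j monom_Suc)
    also have "\<dots> = (\<Sum>k\<le>n. smult (c k * (1 / D k)) (?G k)) + (\<Sum>k\<le>n. smult (c k * (- 1 / D k)) (?G (Suc k)))"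
      unfolding sum.distrib[symmetric] sum_distrib_left
    proof (intro sum.cong refl, goal_cases)
      case (1 k)
      have "[:0, 1:] * smult (c k) (P_poly p x n k) = smult (c k) (pCons 0 (P_poly p x n k))" by simp
      then show ?case using 1 2[of k] by (simp add: smult_add_right smult_diff_right)
    qed
    finally show ?thesis
      using combine_shifted_sums[of "\<lambda>k. c k * (1 / D k)" ?G n "\<lambda>k. c k * (- 1 / D k)"] by simp
  qed
qed

text \<open>The factor with \<open>b = a\<close> of the first product vanishes at this
  point.\<close>

lemma poly_P_poly_eq_0: 
  assumes "0 < p" "a < k"
  shows "poly (P_poly p x n k) (inverse p ^ a) = 0"
proof -
  have "1 - p ^ a * inverse p ^ a = 0" using assms by (simp add: power_inverse)
  then show ?thesis using assms
    by (auto simp: P_poly_def poly_prod mult.commute intro!: prod_zero bexI[of _ a])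
qed

lemma poly_P_poly_pos:
  assumes p: "1 < p" and x: "0 < x"
  shows "poly (P_poly p x n a) (inverse p ^ a) > 0"
proof -
  have "p ^ b * inverse p ^ a < 1" if "b < a" for b
  proof -
    have "p ^ b < p ^ a" using that p by simp
    then show ?thesis using p by (simp add: power_inverse field_simps)
  qed
  then have "(\<Prod>b<a. 1 - p ^ b * inverse p ^ a) > 0" by (intro prod_pos) simp
  moreover have "(\<Prod>b<n - a. 1 + p ^ b * (p * x) * inverse p ^ a) > 0"
    using p x by (intro prod_pos) (auto intro!: add_pos_pos)
  ultimately show ?thesis
    by (simp add: P_poly_def poly_prod mult_ac)
qed

text \<open>At \<open>inverse p ^ a\<close> the polynomials with \<open>k > a\<close> vanish, and
  those with \<open>k < a\<close> have coefficient 0 by induction. Only the nonzero diagonal value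
  is left.\<close>

lemma P_poly_triangular:
  assumes p: "1 < p" and x: "0 < x" and "t \<le> n"
    and 0: "\<And>a. a \<le> t \<Longrightarrow> (\<Sum>k\<le>n. \<delta> k * poly (P_poly p x n k) (inverse p ^ a)) = 0"
    and "a \<le> t"
  shows "\<delta> a = 0"
  using \<open>a \<le> t\<close>
proof (induction a rule: less_induct)
  case (less a)
  have "(\<Sum>k\<le>n. \<delta> k * poly (P_poly p x n k) (inverse p ^ a)) =
        (\<Sum>k\<in>{a}. \<delta> k * poly (P_poly p x n k) (inverse p ^ a))"
  proof (intro sum.mono_neutral_right ballI)
    fix k assume "k \<in> {..n} - {a}"
    then consider "k < a" | "a < k" by fastforce
    then show "\<delta> k * poly (P_poly p x n k) (inverse p ^ a) = 0"
      using less p poly_P_poly_eq_0[of p a k] by cases auto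
  qed (use less.prems \<open>t \<le> n\<close> in auto)
  then show ?case using 0[OF less.prems] poly_P_poly_pos[OF p x, of n a] by simp
qed

text \<open>Multiplication by the matrix of \<open>P\<close>-numbers becomes the evaluation of one
  polynomial, which makes triangularity applicable to it.\<close>

lemma sum_poly_P_poly:
  assumes p: "1 < p"
  shows "(\<Sum>k\<le>n. \<delta> k * poly (P_poly p (p powr e) n k) z) =
         (\<Sum>i\<le>n. (\<Sum>k=0..n. P_number p e n i k * \<delta> k) * z ^ i)"
proof -
  have "(\<Sum>k\<le>n. \<delta> k * poly (P_poly p (p powr e) n k) z) =
      (\<Sum>k\<le>n. \<Sum>i\<le>n. \<delta> k * (P_number p e n i k * z ^ i))"
    by (intro sum.cong refl)
      (simp add: poly_eq_sum_coeff[OF degree_P_poly] P_number_eq_coeff[OF p] sum_distrib_left)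
  also have "\<dots> = (\<Sum>i\<le>n. \<Sum>k\<le>n. \<delta> k * (P_number p e n i k * z ^ i))" by (rule sum.swap)
  finally show ?thesis by (simp add: sum_distrib_left sum_distrib_right atMost_atLeast0 mult_ac)
qed

text \<open>The definite description is justified here: existence since the monomials lie in the
  span of the generating polynomials, uniqueness from triangularity with
  \<open>t = n\<close>.\<close>

lemma Q_number_inverse:
  assumes p: "1 < p" and "i \<le> n" "j \<le> n"
  shows "(\<Sum>k=0..n. P_number p e n i k * Q_number p e n N k j) = (if i = j then real N else 0)"
proof -
  let ?x = "p powr e"
  have x: "?x > 0" using p by simp
  let ?ok = "\<lambda>Q. (\<forall>i\<le>n. \<forall>j\<le>n. (\<Sum>k=0..n. P_number p e n i k * Q k j) = (if i = j then real N else 0)) \<and>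
     (\<forall>k j. n < k \<or> n < j \<longrightarrow> Q k j = (0::real))"
  have "\<forall>j\<in>{..n}. \<exists>c. monom 1 j = (\<Sum>k\<le>n. smult (c k) (P_poly p ?x n k))"
    using monom_in_span_P_poly[OF p x] by simp
  then obtain c where c: "\<And>j. j \<le> n \<Longrightarrow> monom 1 j = (\<Sum>k\<le>n. smult (c j k) (P_poly p ?x n k))"
    unfolding bchoice_iff by auto
  \<comment> \<open>Column \<open>j\<close> consists of \<open>N\<close> times the coordinates of
    the monomial of degree \<open>j\<close>; the value 0 outside the range meets the last condition
    of the definition.\<close>
  define Q where "Q k j = (if n < k \<or> n < j then 0 else real N * c j k)" for k j
  have Q: "?ok Q"
  proof (intro conjI allI impI)
    fix i j assume ij: "i \<le> n" "j \<le> n"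
    have "coeff (monom 1 j) i = (\<Sum>k\<le>n. c j k * coeff (P_poly p ?x n k) i)"
      using c[OF ij(2)] by (simp add: coeff_sum)
    also have "\<dots> = (\<Sum>k\<le>n. P_number p e n i k * c j k)"
      using ij by (intro sum.cong) (simp_all add: P_number_eq_coeff[OF p])
    finally have "(\<Sum>k\<le>n. P_number p e n i k * c j k) = (if i = j then 1 else 0)" by auto
    moreover have "(\<Sum>k=0..n. P_number p e n i k * Q k j) = real N * (\<Sum>k\<le>n. P_number p e n i k * c j k)"
      unfolding sum_distrib_left atMost_atLeast0 using ij by (intro sum.cong) (auto simp: Q_def)
    ultimately show "(\<Sum>k=0..n. P_number p e n i k * Q k j) = (if i = j then real N else 0)" by simp
  qed (simp add: Q_def)
  moreover have "Q' = Q" if Q': "?ok Q'" for Q'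
  proof (intro ext)
    fix k j
    show "Q' k j = Q k j"
    proof (cases "n < k \<or> n < j")
      case False
      have "(\<Sum>k=0..n. P_number p e n i k * (Q' k j - Q k j)) = 0" if "i \<le> n" for i
        using Q Q' that False by (simp add: right_diff_distrib sum_subtractf)
      then have "(\<Sum>k\<le>n. (Q' k j - Q k j) * poly (P_poly p ?x n k) z) = 0" for z
        unfolding sum_poly_P_poly[OF p] by simp
      from P_poly_triangular[OF p x order_refl this, of k] False show ?thesis by simp
    qed (use Q Q' in auto)
  qed
  ultimately have "?ok (Q_number p e n N)"
    unfolding Q_number_def by (rule theI[of ?ok])
  then show ?thesis using assms by blast
qed

section \<open>From binomial sums to the dual distribution\<close>

lemma sum_P_dual:
  assumes p: "1 < p" and "i \<le> n"
  shows "(\<Sum>k=0..n. P_number p e n i k * (\<Sum>j=0..n. Q_number p e n N k j * A j)) = real N * A i"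
proof -
  have "(\<Sum>k=0..n. P_number p e n i k * (\<Sum>j=0..n. Q_number p e n N k j * A j)) =
      (\<Sum>k=0..n. \<Sum>j=0..n. P_number p e n i k * Q_number p e n N k j * A j)"
    by (simp add: sum_distrib_left mult_ac)
  also have "\<dots> = (\<Sum>j=0..n. (\<Sum>k=0..n. P_number p e n i k * Q_number p e n N k j) * A j)"
    unfolding sum_distrib_right by (rule sum.swap)
  also have "\<dots> = (\<Sum>j=0..n. if i = j then real N * A j else 0)"
    using assms by (intro sum.cong) (auto simp: Q_number_inverse)
  finally show ?thesis using assms by simp
qed

text \<open>For \<open>k = 0\<close> the \<open>P\<close>-numbers are the valencies. Exchanging
  binomials extracts that of \<open>n\<close> over \<open>j\<close> and leaves the q-binomial
  product with \<open>n - j\<close> factors, evaluated at 1.\<close>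

lemma sum_gauss_binomial_P_number_0:
  assumes p: "1 < p" and "j \<le> n"
  shows "(\<Sum>i\<le>n. gauss_binomial p (int (n - i)) (int j) * P_number p e n i 0) =
         gauss_binomial p (int n) (int j) * (\<Prod>b<n - j. 1 + p ^ b * (p * p powr e))"
proof -
  let ?R = "\<Prod>b<n - j. [:1, p ^ b * (p * p powr e):]"
  have "(\<Sum>i\<le>n. gauss_binomial p (int (n - i)) (int j) * P_number p e n i 0) =
      (\<Sum>i\<le>n - j. gauss_binomial p (int (n - i)) (int j) * P_number p e n i 0)"
    by (rule sum.mono_neutral_right) (auto simp: gauss_binomial_eq_0 simp del: of_nat_diff)
  also have "\<dots> = (\<Sum>i\<le>n - j. gauss_binomial p (int n) (int j) * coeff ?R i)"
  proof (intro sum.cong refl, goal_cases)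
    case (1 i)
    then have ij: "i \<le> n" "j \<le> n - i" "i \<le> n - j" using assms by auto
    then have "gauss_binomial p (int (n - i)) (int j) * gauss_binomial p (int n) (int i) =
        gauss_binomial p (int n) (int j) * gauss_binomial p (int (n - j)) (int i)"
      using assms q_factorial_pos[OF p, of "n - i"] q_factorial_pos[OF p, of "n - j"]
      by (simp add: gauss_binomial_fact add.commute del: of_nat_diff)
    then show ?case
      using ij by (simp add: P_number_eq_coeff[OF p] P_poly_def coeff_q_binomial[OF p] del: of_nat_diff)
  qed
  also have "\<dots> = gauss_binomial p (int n) (int j) * poly ?R 1"
    by (simp add: poly_eq_sum_coeff[OF degree_prod_linear_le] sum_distrib_left)
  finally show ?thesis by (simp add: poly_prod)
qed

text \<open>By \<open>gauss_binomial_absorb\<close>, each factor \<open>p ^ (n - i)\<close> is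
  traded for a combination of lower indices \<open>j\<close> and \<open>Suc j\<close>. The budget
  \<open>a + j \<le> t\<close> pays for this rise.\<close>

lemma sum_power_eq_0_of_gauss:
  assumes p: "1 < p"
    and 0: "\<And>j. j \<le> t \<Longrightarrow> (\<Sum>i\<le>n. gauss_binomial p (int (n - i)) (int j) * D i) = 0"
    and "a + j \<le> t"
  shows "(\<Sum>i\<le>n. (p ^ (n - i)) ^ a * gauss_binomial p (int (n - i)) (int j) * D i) = 0"
  using \<open>a + j \<le> t\<close>
proof (induction a arbitrary: j)
  case 0
  then show ?case using assms(2)[of j] by simp
next
  case (Suc a)
  have "(p ^ (n - i)) ^ Suc a * gauss_binomial p (int (n - i)) (int j) * D i =
      p ^ j * (p ^ Suc j - 1) * ((p ^ (n - i)) ^ a * gauss_binomial p (int (n - i)) (int (Suc j)) * D i) +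
      p ^ j * ((p ^ (n - i)) ^ a * gauss_binomial p (int (n - i)) (int j) * D i)" for i
  proof -
    have "p ^ (n - i) * gauss_binomial p (int (n - i)) (int j) =
       p ^ j * (p ^ Suc j - 1) * gauss_binomial p (int (n - i)) (int (Suc j)) +
       p ^ j * gauss_binomial p (int (n - i)) (int j)"
      using gauss_binomial_absorb[OF p, of j "n - i"] by (simp only: algebra_simps)
    from arg_cong[OF this, of "\<lambda>z. (p ^ (n - i)) ^ a * D i * z"] show ?thesis
      by (simp only: power_Suc algebra_simps)
  qed
  then show ?case
    using Suc.IH[of j] Suc.IH[of "Suc j"] Suc.prems
    by (simp add: sum.distrib sum_distrib_left[symmetric] del: of_nat_diff of_nat_Suc power_Suc)
qed

text \<open>The difference \<open>D\<close> of \<open>A\<close> and a multiple of the valencies has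
  vanishing binomial sums up to \<open>t\<close>. Its transform \<open>\<delta>\<close> differs from
  the dual distribution only at \<open>k = 0\<close>, and triangularity gives
  \<open>\<delta> k = 0\<close> for all \<open>k \<le> t\<close>.\<close>

lemma dual_distribution_vanishes:
  assumes p: "1 < p" and "t \<le> n"
    and A: "\<And>j. j \<le> t \<Longrightarrow> (\<Sum>i\<le>n. gauss_binomial p (int (n - i)) (int j) * A i) =
              gauss_binomial p (int n) (int j) * (\<Prod>l=j..<t. 1 + p ^ (n - l) * p powr e)"
    and k: "1 \<le> k" "k \<le> t"
  shows "(\<Sum>j=0..n. Q_number p e n N k j * A j) = 0"
proof -
  define x where "x = p powr e"
  have x: "x > 0" using p by (simp add: x_def)
  define f where "f m = 1 + p ^ m * x" for m
  have f: "f m > 0" for m using p x by (simp add: f_def add_pos_pos)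
  have shift: "(\<Prod>b<n - j. 1 + p ^ b * (p * x)) = (\<Prod>l=j..<t. f (n - l)) * (\<Prod>l=t..<n. f (n - l))"
    if "j \<le> t" for j
  proof -
    have "(\<Prod>b<n - j. 1 + p ^ b * (p * x)) = (\<Prod>l=j..<n. f (n - l))"
      by (rule prod.reindex_bij_witness[of _ "\<lambda>l. n - Suc l" "\<lambda>b. n - Suc b"])
        (auto simp: f_def Suc_diff_Suc simp flip: power_Suc2 mult.assoc)
    also have "\<dots> = (\<Prod>l=j..<t. f (n - l)) * (\<Prod>l=t..<n. f (n - l))"
      using that \<open>t \<le> n\<close> by (simp add: prod.atLeastLessThan_concat)
    finally show ?thesis .
  qed
  \<comment> \<open>The ratio of the sizes of a Steiner system and of the whole set of generators;
    with it the sums for \<open>A\<close> and for the valencies agree for every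
    \<open>j \<le> t\<close>.\<close>
  define c where "c = 1 / (\<Prod>l=t..<n. f (n - l))"
  have c: "c * (\<Prod>l=t..<n. f (n - l)) = 1"
    using prod_pos[of "{t..<n}" "\<lambda>l. f (n - l)"] f unfolding c_def by (simp add: less_imp_neq[symmetric])
  define D where "D i = A i - c * P_number p e n i 0" for i
  have D: "(\<Sum>i\<le>n. gauss_binomial p (int (n - i)) (int j) * D i) = 0" if "j \<le> t" for j
  proof -
    have "(\<Sum>i\<le>n. gauss_binomial p (int (n - i)) (int j) * D i) =
       (\<Sum>i\<le>n. gauss_binomial p (int (n - i)) (int j) * A i) -
       c * (\<Sum>i\<le>n. gauss_binomial p (int (n - i)) (int j) * P_number p e n i 0)"
      by (simp add: D_def right_diff_distrib sum_subtractf sum_distrib_left mult_ac del: of_nat_diff)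
    also have "\<dots> = gauss_binomial p (int n) (int j) * (\<Prod>l=j..<t. f (n - l)) *
        (1 - c * (\<Prod>l=t..<n. f (n - l)))"
      using that \<open>t \<le> n\<close> shift[of j]
      by (subst A, simp, subst sum_gauss_binomial_P_number_0[OF p])
        (simp_all add: x_def[symmetric] f_def[symmetric] right_diff_distrib)
    finally show ?thesis using c by simp
  qed
  define \<delta> where "\<delta> k = (\<Sum>j=0..n. Q_number p e n N k j * A j) - (if k = 0 then real N * c else 0)" for k
  have P\<delta>: "(\<Sum>k=0..n. P_number p e n i k * \<delta> k) = real N * D i" if "i \<le> n" for i
  proof -
    have "(\<Sum>k=0..n. P_number p e n i k * \<delta> k) =
       real N * A i - (\<Sum>k=0..n. if k = 0 then P_number p e n i k * (real N * c) else 0)"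
      unfolding sum_P_dual[OF p that, of e N A, symmetric] sum_subtractf[symmetric]
      by (intro sum.cong refl) (auto simp: \<delta>_def right_diff_distrib)
    then show ?thesis by (simp add: D_def algebra_simps)
  qed
  have "(\<Sum>k\<le>n. \<delta> k * poly (P_poly p x n k) (inverse p ^ a)) = 0" if "a \<le> t" for a
  proof -
    \<comment> \<open>Clearing denominators turns the evaluation at \<open>inverse p ^ a\<close>
      into a sum of powers of \<open>p ^ (n - i)\<close>, to which
      \<open>sum_power_eq_0_of_gauss\<close> applies with \<open>j = 0\<close>.\<close>
    have pw: "p ^ (a * n) * (inverse p ^ a) ^ i = (p ^ (n - i)) ^ a" if "i \<le> n" for i
    proof -
      have "a * n = a * i + (n - i) * a" using that
        by (metis add_mult_distrib2 le_add_diff_inverse mult.commute)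
      then show ?thesis using p by (simp add: power_add power_mult[symmetric] power_inverse)
    qed
    have "p ^ (a * n) * (\<Sum>k\<le>n. \<delta> k * poly (P_poly p x n k) (inverse p ^ a)) =
        p ^ (a * n) * (\<Sum>i\<le>n. (real N * D i) * (inverse p ^ a) ^ i)"
      unfolding x_def sum_poly_P_poly[OF p] using P\<delta> by simp
    also have "\<dots> = real N * (\<Sum>i\<le>n. (p ^ (n - i)) ^ a * gauss_binomial p (int (n - i)) (int 0) * D i)"
      unfolding sum_distrib_left by (intro sum.cong refl) (simp add: pw[symmetric])
    also have "\<dots> = 0" using sum_power_eq_0_of_gauss[OF p, of t n D a 0] D that by simp
    finally show ?thesis using p by simp
  qed
  from P_poly_triangular[OF p x \<open>t \<le> n\<close> this \<open>k \<le> t\<close>] k show ?thesis by (simp add: \<delta>_def)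
qed

section \<open>Counting subspaces of finite vector spaces\<close>

lemma card_field_gt_1: "1 < real CARD('f::{field,finite})"
proof -
  have "card {0, 1 :: 'f} \<le> CARD('f)" by (rule card_mono) auto
  then show ?thesis by simp
qed

lemma double_count:
  assumes "finite A" "finite B"
  shows "(\<Sum>a\<in>A. card {b\<in>B. R a b}) = (\<Sum>b\<in>B. card {a\<in>A. R a b})"
  using sum.swap_restrict[OF assms, of "\<lambda>_ _. 1::nat" R] by simp

lemma span_insert_subspace_le:
  "vec.subspace U \<Longrightarrow> T \<subseteq> U \<Longrightarrow> u \<in> U \<Longrightarrow> vec.span (insert u T) \<subseteq> U"
  by (rule vec.span_minimal) auto

lemma span_of_subspace: "vec.subspace T \<Longrightarrow> vec.span T = T"
  by simp

lemma dim_insert_subspace: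
  "vec.subspace T \<Longrightarrow> u \<notin> T \<Longrightarrow> vec.dim (insert u T) = Suc (vec.dim T)"
  by (simp add: vec.dim_insert span_of_subspace)

lemma span_insert_eq:
  assumes "vec.subspace U" "vec.subspace T" "T \<subseteq> U" "u \<in> U" "u \<notin> T" "vec.dim U = Suc (vec.dim T)"
  shows "vec.span (insert u T) = U"
  using assms by (intro vec.subspace_dim_equal) (auto simp: dim_insert_subspace span_insert_subspace_le)

lemma span_insert_explicit:
  assumes "vec.subspace T"
  shows "vec.span (insert u T) = (\<lambda>(t, c). t + c *s u) ` (T \<times> UNIV)"
proof -
  have "\<And>v k. v - k *s u \<in> T \<Longrightarrow> v \<in> (\<lambda>(t, c). t + c *s u) ` (T \<times> UNIV)"
    by (rule_tac x="(v - k *s u, k)" in image_eqI) auto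
  moreover have "\<exists>k. t + c *s u - k *s u \<in> T" if "t \<in> T" for t c
    using that by (intro exI[of _ c]) simp
  ultimately show ?thesis unfolding vec.span_insert span_of_subspace[OF assms] by auto
qed

lemma card_span_insert:
  fixes T :: "('f::{field,finite} ^ 'm) set"
  assumes T: "vec.subspace T" and u: "u \<notin> T"
  shows "card (vec.span (insert u T)) = CARD('f) * card T"
proof -
  have "inj_on (\<lambda>(t, c). t + c *s u) (T \<times> UNIV)"
  proof (intro inj_onI, clarsimp)
    fix s c t d assume st: "s \<in> T" "t \<in> T" and eq: "s + c *s u = t + d *s u"
    then have *: "(d - c) *s u = s - t" by (simp add: vec.scale_left_diff_distrib algebra_simps)
    have "c = d"
    proof (rule ccontr)
      assume "c \<noteq> d"
      then have "u = inverse (d - c) *s (s - t)" unfolding *[symmetric] by simp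
      then show False using u T st by (metis vec.subspace_diff vec.subspace_scale)
    qed
    with eq show "s = t \<and> c = d" by simp
  qed
  then show ?thesis unfolding span_insert_explicit[OF T] by (simp add: card_image card_cartesian_product)
qed

lemma subspace_split:
  assumes U: "vec.subspace U" and "vec.dim U = Suc k"
  obtains T u where "vec.subspace T" "vec.dim T = k" "T \<subseteq> U" "u \<in> U" "u \<notin> T" "vec.span (insert u T) = U"
proof -
  obtain T where T: "vec.subspace T" "T \<subseteq> vec.span U" "vec.dim T = k"
    using assms vec.choose_subspace_of_subspace[of k U] by auto
  moreover note span_of_subspace[OF U]
  moreover have "U \<noteq> T" using assms T by auto
  ultimately obtain u where "u \<in> U" "u \<notin> T" by blast
  then show ?thesis using that[of T u] T assms span_of_subspace[OF U] by (simp add: span_insert_eq)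
qed

lemma card_subspace:
  fixes U :: "('f::{field,finite} ^ 'm) set"
  assumes "vec.subspace U"
  shows "card U = CARD('f) ^ vec.dim U"
  using assms
proof (induction "vec.dim U" arbitrary: U)
  case 0
  then have "U = {0}" using vec.subspace_0[of U] vec.dim_eq_0[of U] by auto
  then show ?case by simp
next
  case (Suc k)
  obtain T u where T: "vec.subspace T" "vec.dim T = k" "u \<notin> T" "vec.span (insert u T) = U"
    using subspace_split[of U k] Suc by metis
  then show ?case using card_span_insert[of T u] Suc by (metis power_Suc)
qed

lemma card_UNIV_vec: "CARD('f::{field,finite} ^ 'm) = CARD('f) ^ CARD('m)"
  using card_subspace[of "UNIV :: ('f ^ 'm) set"] by (simp add: vec_dim_card)

text \<open>Rank-nullity in terms of cardinalities: subtracting \<open>(f v / f w) *s w\<close>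
  moves any \<open>v\<close> into the kernel, so \<open>w\<close> and the kernel span
  \<open>W\<close>.\<close>

lemma card_kernel:
  fixes W :: "('f::{field,finite} ^ 'm) set"
  assumes f: "linear_functional f" and W: "vec.subspace W" and w: "w \<in> W" "f w \<noteq> 0"
  shows "card W = CARD('f) * card {v \<in> W. f v = 0}"
proof -
  interpret f: Vector_Spaces.linear "(*s)" "(*)" f by fact
  let ?K = "{v \<in> W. f v = 0}"
  have K: "vec.subspace ?K"
    using W by (auto simp: vec.subspace_def f.zero f.add f.scale)
  have "v \<in> vec.span (insert w ?K)" if "v \<in> W" for v
  proof -
    have "v - (f v / f w) *s w \<in> ?K" using that W w
      by (simp add: f.diff f.scale vec.subspace_diff vec.subspace_scale)
    then have "v - (f v / f w) *s w \<in> vec.span ?K" by (rule vec.span_base)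
    then show ?thesis unfolding vec.span_breakdown_eq ..
  qed
  then have "vec.span (insert w ?K) = W" using w W by (intro equalityI span_insert_subspace_le) auto
  then show ?thesis using card_span_insert[OF K, of w] w by simp
qed

text \<open>Every vector of \<open>M - T\<close> lies in exactly one of the counted subspaces, which contains
  \<open>q^(j+1) - q^j\<close> such vectors.\<close>

lemma card_one_step_extensions:
  fixes T M :: "('f::{field,finite} ^ 'm) set"
  assumes T: "vec.subspace T" and "T \<subseteq> M"
    and M: "\<And>v. v \<in> M \<Longrightarrow> v \<notin> T \<Longrightarrow> vec.span (insert v T) \<subseteq> M"
  defines "K \<equiv> real CARD('f)" and "j \<equiv> vec.dim T"
  shows "real (card {A. vec.subspace A \<and> T \<subseteq> A \<and> A \<subseteq> M \<and> vec.dim A = Suc j}) * (K ^ Suc j - K ^ j) =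
         real (card M) - K ^ j"
proof -
  let ?E = "{A. vec.subspace A \<and> T \<subseteq> A \<and> A \<subseteq> M \<and> vec.dim A = Suc j}"
  have *: "A = vec.span (insert v T)" if "A \<in> ?E" "v \<in> A - T" for A v
    using that T by (intro span_insert_eq[symmetric]) (auto simp: j_def)
  have cover: "M - T = (\<Union>A\<in>?E. A - T)"
  proof (intro equalityI subsetI)
    fix v assume v: "v \<in> M - T"
    have "vec.span (insert v T) \<in> ?E" using v M T
      by (auto simp: dim_insert_subspace j_def intro: vec.span_base)
    moreover have "v \<in> vec.span (insert v T)" by (simp add: vec.span_base)
    ultimately show "v \<in> (\<Union>A\<in>?E. A - T)" using v by blast
  qed auto
  have "card (M - T) = (\<Sum>A\<in>?E. card (A - T))"
    unfolding cover
  proof (rule card_UN_disjoint; (intro ballI impI)?)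
    fix A B assume AB: "A \<in> ?E" "B \<in> ?E" "A \<noteq> B"
    have False if "v \<in> A - T" "v \<in> B - T" for v
      using *[OF AB(1) that(1)] *[OF AB(2) that(2)] AB(3) by simp
    then show "(A - T) \<inter> (B - T) = {}" by blast
  qed simp_all
  then have "real (card (M - T)) = (\<Sum>A\<in>?E. real (card (A - T)))" by simp
  also have "\<dots> = (\<Sum>A\<in>?E. K ^ Suc j - K ^ j)"
  proof (intro sum.cong refl)
    fix A assume "A \<in> ?E"
    then show "real (card (A - T)) = K ^ Suc j - K ^ j"
      using T card_subspace[OF T] card_subspace[of A] card_mono[of A T]
      by (simp add: card_Diff_subset of_nat_diff K_def j_def)
  qed
  also have "real (card (M - T)) = real (card M) - K ^ j"
    using card_subspace[OF T] card_mono[of M T] \<open>T \<subseteq> M\<close>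
    by (simp add: card_Diff_subset of_nat_diff K_def j_def)
  finally show ?thesis by simp
qed

lemma card_one_step_in_subspace:
  fixes T V :: "('f::{field,finite} ^ 'm) set"
  assumes "vec.subspace T" "vec.subspace V" "T \<subseteq> V"
  defines "K \<equiv> real CARD('f)"
  shows "real (card {A. vec.subspace A \<and> T \<subseteq> A \<and> A \<subseteq> V \<and> vec.dim A = Suc (vec.dim T)}) =
         (K ^ (vec.dim V - vec.dim T) - 1) / (K - 1)"
proof -
  let ?c = "real (card {A. vec.subspace A \<and> T \<subseteq> A \<and> A \<subseteq> V \<and> vec.dim A = Suc (vec.dim T)})"
  have K: "K > 1" using card_field_gt_1 by (simp add: K_def)
  have "vec.dim T \<le> vec.dim V" using assms by (simp add: vec.dim_subset)
  then have V: "K ^ vec.dim V = K ^ vec.dim T * K ^ (vec.dim V - vec.dim T)" by (simp flip: power_add)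
  have "?c * (K ^ Suc (vec.dim T) - K ^ vec.dim T) = K ^ vec.dim V - K ^ vec.dim T"
    using card_one_step_extensions[of T V] assms span_insert_subspace_le[of V T] card_subspace[of V]
    by (simp add: K_def)
  then have "K ^ vec.dim T * (?c * (K - 1)) = K ^ vec.dim T * (K ^ (vec.dim V - vec.dim T) - 1)"
    unfolding V by (simp add: algebra_simps)
  then have "?c * (K - 1) = K ^ (vec.dim V - vec.dim T) - 1" using K by simp
  then show ?thesis using K by (simp add: eq_divide_eq)
qed

text \<open>Double counting of pairs \<open>B \<subseteq> T\<close> with \<open>B\<close> one
  dimension above \<open>A\<close>: the pairs over a fixed \<open>T\<close> are counted by the
  one-step lemma, those over a fixed \<open>B\<close> by induction. The result is the recursion
  \<open>gauss_binomial_rec\<close>.\<close>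

lemma card_subspaces_between:
  fixes A V :: "('f::{field,finite} ^ 'm) set"
  assumes A: "vec.subspace A" and V: "vec.subspace V" and "A \<subseteq> V" and "r \<le> vec.dim V - vec.dim A"
  shows "real (card {T. vec.subspace T \<and> A \<subseteq> T \<and> T \<subseteq> V \<and> vec.dim T = vec.dim A + r}) =
         gauss_binomial (real CARD('f)) (int (vec.dim V - vec.dim A)) (int r)"
  using A \<open>A \<subseteq> V\<close> \<open>r \<le> vec.dim V - vec.dim A\<close>
proof (induction r arbitrary: A)
  case 0
  then have "{T. vec.subspace T \<and> A \<subseteq> T \<and> T \<subseteq> V \<and> vec.dim T = vec.dim A + 0} = {A}"
    by (auto dest!: vec.subspace_dim_equal[of A])
  then show ?case by simp
next
  case (Suc r)
  define K where "K = real CARD('f)"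
  have K: "K > 1" using card_field_gt_1 by (simp add: K_def)
  let ?a = "vec.dim A"
  obtain m where m: "vec.dim V - ?a = Suc m" using Suc.prems by (cases "vec.dim V - ?a") auto
  define E where "E = {B. vec.subspace B \<and> A \<subseteq> B \<and> B \<subseteq> V \<and> vec.dim B = Suc ?a}"
  define F where "F = {T. vec.subspace T \<and> A \<subseteq> T \<and> T \<subseteq> V \<and> vec.dim T = ?a + Suc r}"
  have "(\<Sum>T\<in>F. real (card {B\<in>E. B \<subseteq> T})) = (\<Sum>B\<in>E. real (card {T\<in>F. B \<subseteq> T}))"
    using double_count[of F E "\<lambda>T B. B \<subseteq> T"] by (simp flip: of_nat_sum)
  also have "(\<Sum>T\<in>F. real (card {B\<in>E. B \<subseteq> T})) = (\<Sum>T\<in>F. (K ^ Suc r - 1) / (K - 1))"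
  proof (intro sum.cong refl)
    fix T assume T: "T \<in> F"
    then have "{B\<in>E. B \<subseteq> T} = {B. vec.subspace B \<and> A \<subseteq> B \<and> B \<subseteq> T \<and> vec.dim B = Suc ?a}"
      by (auto simp: E_def F_def)
    then show "real (card {B\<in>E. B \<subseteq> T}) = (K ^ Suc r - 1) / (K - 1)"
      using T Suc.prems card_one_step_in_subspace[of A T] by (simp add: F_def K_def)
  qed
  also have "(\<Sum>B\<in>E. real (card {T\<in>F. B \<subseteq> T})) = (\<Sum>B\<in>E. gauss_binomial K (int m) (int r))"
  proof (intro sum.cong refl)
    fix B assume B: "B \<in> E"
    then have eq: "{T\<in>F. B \<subseteq> T} = {T. vec.subspace T \<and> B \<subseteq> T \<and> T \<subseteq> V \<and> vec.dim T = vec.dim B + r}"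
      by (auto simp: E_def F_def)
    have "vec.dim V - vec.dim B = m" using B m by (simp add: E_def)
    with Suc.IH[of B] B Suc.prems m show "real (card {T\<in>F. B \<subseteq> T}) = gauss_binomial K (int m) (int r)"
      unfolding eq K_def by (simp add: E_def)
  qed
  finally have "real (card F) * (K ^ Suc r - 1) = real (card E) * (K - 1) * gauss_binomial K (int m) (int r)"
    using K by (simp add: field_simps)
  also have "real (card E) * (K - 1) = K ^ Suc m - 1"
    using card_one_step_in_subspace[of A V] Suc.prems V K m by (simp add: E_def K_def[symmetric])
  also have "(K ^ Suc m - 1) * gauss_binomial K (int m) (int r) =
      gauss_binomial K (int (Suc m)) (int (Suc r)) * (K ^ Suc r - 1)"
    using gauss_binomial_rec[OF K, of r m] Suc.prems m by simp
  finally have "real (card F) = gauss_binomial K (int (Suc m)) (int (Suc r))"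
    using power_Suc_minus_1_pos[OF K, of r] by (simp del: power_Suc of_nat_Suc)
  then show ?case by (simp only: F_def K_def m)
qed

lemma card_subspaces:
  fixes V :: "('f::{field,finite} ^ 'm) set"
  assumes V: "vec.subspace V"
  shows "real (card {T. vec.subspace T \<and> T \<subseteq> V \<and> vec.dim T = j}) =
         gauss_binomial (real CARD('f)) (int (vec.dim V)) (int j)"
proof (cases "j \<le> vec.dim V")
  case True
  have "{T. vec.subspace T \<and> T \<subseteq> V \<and> vec.dim T = j} =
      {T. vec.subspace T \<and> {0} \<subseteq> T \<and> T \<subseteq> V \<and> vec.dim T = vec.dim {0::'f^'m} + j}"
    by (auto simp: vec.subspace_0)
  then show ?thesis
    using card_subspaces_between[of "{0}" V j] V True by (simp add: vec.subspace_0)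
next
  case False
  then have "{T. vec.subspace T \<and> T \<subseteq> V \<and> vec.dim T = j} = {}" using vec.dim_subset by auto
  then show ?thesis using False by (simp add: gauss_binomial_eq_0)
qed

section \<open>Steiner systems\<close>

text \<open>The parameters \<open>K\<close> and \<open>x\<close> correspond to \<open>p\<close> and \<open>p^e\<close>.\<close>

locale polar_family =
  fixes S :: "('f::{field,finite} ^ 'm) set set" and n :: nat and x K :: real
  assumes K_def: "K = real CARD('f)"
    and subspace: "U \<in> S \<Longrightarrow> vec.subspace U"
    and downward: "U \<in> S \<Longrightarrow> vec.subspace T \<Longrightarrow> T \<subseteq> U \<Longrightarrow> T \<in> S"
    and zero: "{0} \<in> S"
    and dim_generator: "U \<in> generators S \<Longrightarrow> vec.dim U = n"
    and card_extensions: "T \<in> S \<Longrightarrow> vec.dim T < n \<Longrightarrow>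
      real (card {A \<in> S. T \<subseteq> A \<and> vec.dim A = Suc (vec.dim T)}) =
      (K ^ (n - vec.dim T) - 1) / (K - 1) * (1 + K ^ (n - vec.dim T) * x)"
begin

lemma K_gt_1: "K > 1"
  using card_field_gt_1 by (simp add: K_def)

lemma subset_generator:
  assumes "T \<in> S"
  obtains U where "U \<in> generators S" "T \<subseteq> U"
proof -
  obtain U where "U \<in> S" "T \<subseteq> U" "\<forall>W\<in>S. U \<subseteq> W \<longrightarrow> U = W"
    using finite_has_maximal2[of S T] assms by auto
  then show ?thesis using that[of U] by (auto simp: generators_def)
qed

text \<open>Downward induction on the dimension of \<open>T\<close>, counting pairs of a one-step
  extension \<open>A\<close> and a block containing it. Each block contains \<open>q\<close>
  extensions, and \<open>q\<close> is also a factor of their total number, so it cancels.\<close>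

lemma steiner_count:
  assumes Y: "steiner_system S t Y" and "t \<le> n" and "T \<in> S" "vec.dim T \<le> t"
  shows "real (card {U\<in>Y. T \<subseteq> U}) = (\<Prod>l=vec.dim T..<t. 1 + K ^ (n - l) * x)"
  using \<open>T \<in> S\<close> \<open>vec.dim T \<le> t\<close>
proof (induction "t - vec.dim T" arbitrary: T)
  case 0
  then have "\<exists>!U. U \<in> Y \<and> T \<subseteq> U" using Y by (auto simp: steiner_system_def)
  then have "\<exists>U. {U\<in>Y. T \<subseteq> U} = {U}" by auto
  then show ?case using 0 by auto
next
  case (Suc r)
  let ?j = "vec.dim T"
  have j: "?j < t" "?j < n" using Suc \<open>t \<le> n\<close> by auto
  let ?Y = "{U\<in>Y. T \<subseteq> U}"
  define E where "E = {A \<in> S. T \<subseteq> A \<and> vec.dim A = Suc ?j}"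
  define q where "q = (K ^ (n - ?j) - 1) / (K - 1)"
  have "K ^ (n - ?j) > 1" using K_gt_1 j by (intro one_less_power) auto
  then have q: "q > 0" using K_gt_1 by (simp add: q_def)
  have "(\<Sum>U\<in>?Y. real (card {A\<in>E. A \<subseteq> U})) = (\<Sum>A\<in>E. real (card {U\<in>?Y. A \<subseteq> U}))"
    using double_count[of ?Y E "\<lambda>U A. A \<subseteq> U"] by (simp flip: of_nat_sum)
  also have "(\<Sum>U\<in>?Y. real (card {A\<in>E. A \<subseteq> U})) = (\<Sum>U\<in>?Y. q)"
  proof (intro sum.cong refl)
    fix U assume U: "U \<in> ?Y"
    then have G: "U \<in> generators S" "U \<in> S" using Y by (auto simp: steiner_system_def generators_def)
    have "A \<in> S \<longleftrightarrow> vec.subspace A" if "A \<subseteq> U" for A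
      using downward[OF G(2) _ that] subspace[of A] by blast
    then have "{A\<in>E. A \<subseteq> U} = {A. vec.subspace A \<and> T \<subseteq> A \<and> A \<subseteq> U \<and> vec.dim A = Suc ?j}"
      by (auto simp: E_def)
    then show "real (card {A\<in>E. A \<subseteq> U}) = q"
      using card_one_step_in_subspace[of T U] U G Suc.prems
      by (simp add: subspace dim_generator q_def K_def)
  qed
  also have "(\<Sum>A\<in>E. real (card {U\<in>?Y. A \<subseteq> U})) = (\<Sum>A\<in>E. \<Prod>l=Suc ?j..<t. 1 + K ^ (n - l) * x)"
  proof (intro sum.cong refl)
    fix A assume A: "A \<in> E"
    then have "{U\<in>?Y. A \<subseteq> U} = {U\<in>Y. A \<subseteq> U}" by (auto simp: E_def)
    then show "real (card {U\<in>?Y. A \<subseteq> U}) = (\<Prod>l=Suc ?j..<t. 1 + K ^ (n - l) * x)"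
      using Suc.hyps(1)[of A] Suc.hyps(2) A j by (simp add: E_def)
  qed
  finally have "real (card ?Y) * q = q * ((1 + K ^ (n - ?j) * x) * (\<Prod>l=Suc ?j..<t. 1 + K ^ (n - l) * x))"
    using card_extensions[OF \<open>T \<in> S\<close> j(2)] by (simp add: E_def q_def)
  then show ?case using q j by (simp add: prod.atLeast_Suc_lessThan)
qed

text \<open>For \<open>j \<le> t\<close> this counts pairs of a \<open>j\<close>-space of
  \<open>U\<close> and a block through it. For \<open>j > t\<close> distinct blocks meet in
  dimension below \<open>t\<close>, so only \<open>W = U\<close> contributes and the product is
  empty. The inversion later uses all \<open>j \<le> n\<close>.\<close>

lemma sum_block_intersections:
  assumes Y: "steiner_system S t Y" and "t \<le> n" and U: "U \<in> Y"
  shows "(\<Sum>W\<in>Y. gauss_binomial K (int (vec.dim (U \<inter> W))) (int j)) =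
         gauss_binomial K (int n) (int j) * (\<Prod>l=j..<t. 1 + K ^ (n - l) * x)"
proof -
  have YG: "W \<in> generators S" "W \<in> S" "vec.subspace W" "vec.dim W = n" if "W \<in> Y" for W
    using that Y dim_generator[of W] subspace[of W] by (auto simp: steiner_system_def generators_def)
  show ?thesis
  proof (cases "j \<le> t")
    case True
    define E where "E = {T. vec.subspace T \<and> T \<subseteq> U \<and> vec.dim T = j}"
    have "(\<Sum>W\<in>Y. gauss_binomial K (int (vec.dim (U \<inter> W))) (int j)) = (\<Sum>W\<in>Y. real (card {T\<in>E. T \<subseteq> W}))"
    proof (intro sum.cong refl)
      fix W assume "W \<in> Y"
      moreover have "{T\<in>E. T \<subseteq> W} = {T. vec.subspace T \<and> T \<subseteq> U \<inter> W \<and> vec.dim T = j}"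
        by (auto simp: E_def)
      ultimately show "gauss_binomial K (int (vec.dim (U \<inter> W))) (int j) = real (card {T\<in>E. T \<subseteq> W})"
        using card_subspaces[of "U \<inter> W" j] YG U by (simp add: vec.subspace_inter K_def)
    qed
    also have "\<dots> = (\<Sum>T\<in>E. real (card {W\<in>Y. T \<subseteq> W}))"
      using double_count[of Y E "\<lambda>W T. T \<subseteq> W"] by (simp flip: of_nat_sum)
    also have "\<dots> = (\<Sum>T\<in>E. \<Prod>l=j..<t. 1 + K ^ (n - l) * x)"
      using steiner_count[OF Y \<open>t \<le> n\<close>] True YG[OF U] downward by (intro sum.cong) (auto simp: E_def)
    finally show ?thesis using card_subspaces[of U j] YG[OF U] by (simp add: E_def K_def)
  next
    case False
    have "vec.dim (U \<inter> W) < t" if "W \<in> Y" "W \<noteq> U" for W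
    proof (rule ccontr)
      assume "\<not> vec.dim (U \<inter> W) < t"
      moreover have UW: "vec.subspace (U \<inter> W)" using YG that U by (simp add: vec.subspace_inter)
      ultimately obtain T where T: "vec.subspace T" "T \<subseteq> U \<inter> W" "vec.dim T = t"
        using vec.choose_subspace_of_subspace[of t "U \<inter> W"] span_of_subspace[OF UW]
        by (metis not_le_imp_less)
      then have "T \<in> S" using downward[of U T] YG[OF U] by auto
      then have "\<exists>!V. V \<in> Y \<and> T \<subseteq> V" using T Y by (auto simp: steiner_system_def)
      then show False using T U that by auto
    qed
    then have "vec.dim (U \<inter> W) < j" if "W \<in> Y - {U}" for W using that False by fastforce
    then have "(\<Sum>W\<in>Y. gauss_binomial K (int (vec.dim (U \<inter> W))) (int j)) =
       (\<Sum>W\<in>{U}. gauss_binomial K (int (vec.dim (U \<inter> W))) (int j))"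
      using U by (intro sum.mono_neutral_right) (auto intro!: gauss_binomial_eq_0)
    then show ?thesis using False YG[OF U] by simp
  qed
qed

lemma sum_inner_distribution:
  assumes Y: "steiner_system S t Y" and "t \<le> n"
  shows "(\<Sum>i\<le>n. gauss_binomial K (int (n - i)) (int j) * inner_distribution n (generators S) Y i) =
         gauss_binomial K (int n) (int j) * (\<Prod>l=j..<t. 1 + K ^ (n - l) * x)"
proof -
  have YG: "W \<in> generators S" "vec.subspace W" "vec.dim W = n" if "W \<in> Y" for W
    using that Y dim_generator[of W] subspace[of W] by (auto simp: steiner_system_def generators_def)
  \<comment> \<open>Division by \<open>card Y\<close> has to be meaningful: some generator contains
    a \<open>t\<close>-space, and a block covers it.\<close>
  have "Y \<noteq> {}"
  proof -
    obtain G where G: "G \<in> generators S" using subset_generator[OF zero] by blast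
    then have GS: "G \<in> S" by (simp add: generators_def)
    obtain T where T: "vec.subspace T" "T \<subseteq> vec.span G" "vec.dim T = t"
      using vec.choose_subspace_of_subspace[of t G] dim_generator[OF G] \<open>t \<le> n\<close> by auto
    then have "T \<in> S" using downward[OF GS] span_of_subspace[OF subspace[OF GS]] by simp
    then show ?thesis using Y T by (auto simp: steiner_system_def)
  qed
  then have Y0: "real (card Y) \<noteq> 0" by simp
  \<comment> \<open>Fibres of a function partition \<open>Y \<times> Y\<close>, as
    \<open>sum.group\<close> requires; for \<open>i \<le> n\<close> they agree with the scheme
    relations because intersections have dimension at most \<open>n\<close>.\<close>
  define R where "R i = {(U, W) \<in> Y \<times> Y. n - vec.dim (U \<inter> W) = i}" for i
  have dim_le: "vec.dim (U \<inter> W) \<le> n" if "U \<in> Y" for U W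
    using vec.dim_subset[of "U \<inter> W" U] YG(3)[OF that] by simp
  have R: "(Y \<times> Y) \<inter> scheme_relation n (generators S) i = R i" if "i \<le> n" for i
    using that YG dim_le by (force simp: R_def scheme_relation_def)
  let ?g = "\<lambda>(U, W). gauss_binomial K (int (vec.dim (U \<inter> W))) (int j)"
  have "(\<Sum>i\<le>n. gauss_binomial K (int (n - i)) (int j) * inner_distribution n (generators S) Y i) =
      (\<Sum>i\<le>n. \<Sum>P\<in>R i. ?g P) / real (card Y)"
    unfolding sum_divide_distrib[where A="{..n}"]
  proof (intro sum.cong refl)
    fix i assume i: "i \<in> {..n}"
    have "(\<Sum>P\<in>R i. ?g P) = (\<Sum>P\<in>R i. gauss_binomial K (int (n - i)) (int j))"
      using dim_le by (intro sum.cong refl) (auto simp: R_def simp del: of_nat_diff)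
    then show "gauss_binomial K (int (n - i)) (int j) * inner_distribution n (generators S) Y i =
        (\<Sum>P\<in>R i. ?g P) / real (card Y)"
      using i by (simp add: inner_distribution_def R)
  qed
  also have "(\<Sum>i\<le>n. \<Sum>P\<in>R i. ?g P) = (\<Sum>P\<in>Y \<times> Y. ?g P)"
    unfolding R_def
    using sum.group[of "Y \<times> Y" "{..n}" "\<lambda>(U, W). n - vec.dim (U \<inter> W)" ?g]
    by (simp add: image_subset_iff case_prod_unfold mem_Times_iff)
  also have "\<dots> = (\<Sum>U\<in>Y. \<Sum>W\<in>Y. gauss_binomial K (int (vec.dim (U \<inter> W))) (int j))"
    by (simp add: sum.cartesian_product)
  also have "\<dots> = (\<Sum>U\<in>Y. gauss_binomial K (int n) (int j) * (\<Prod>l=j..<t. 1 + K ^ (n - l) * x))"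
    using sum_block_intersections[OF Y \<open>t \<le> n\<close>] by simp
  finally show ?thesis using Y0 by simp
qed

text \<open>q-binomial inversion of \<open>sum_inner_distribution\<close>, with the distribution
  indexed by the dimension \<open>m\<close> of the intersection.\<close>

lemma inner_distribution_formula:
  assumes Y: "steiner_system S t Y" and "t \<le> n" and "i < n"
  shows "inner_distribution n (generators S) Y (n - i) =
         (\<Sum>j=i..<t. (-1) ^ (j - i) * K ^ ((j - i) choose 2) * gauss_binomial K j i *
            gauss_binomial K n j * ((\<Prod>l=j..<t. 1 + K ^ (n - l) * x) - 1))"
proof -
  define A where "A m = inner_distribution n (generators S) Y (n - m)" for m
  define \<mu> where "\<mu> j = (-1) ^ (j - i) * K ^ ((j - i) choose 2) * gauss_binomial K (int j) (int i)" for j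
  have inv: "(\<Sum>j=i..n. \<mu> j * gauss_binomial K (int m) (int j)) = (if m = i then 1 else 0)" if "m \<le> n" for m
    using gauss_inversion[OF K_gt_1 that, of i] by (simp add: \<mu>_def)
  have sumA: "(\<Sum>m\<le>n. gauss_binomial K (int m) (int j) * A m) =
      gauss_binomial K (int n) (int j) * (\<Prod>l=j..<t. 1 + K ^ (n - l) * x)" for j
    unfolding sum_inner_distribution[OF Y \<open>t \<le> n\<close>, symmetric] A_def
    by (rule sum.reindex_bij_witness[of _ "\<lambda>i. n - i" "\<lambda>i. n - i"]) auto
  have "A i = (\<Sum>m\<le>n. (if m = i then 1 else 0) * A m)"
    using \<open>i < n\<close> by (simp add: if_distrib[of "\<lambda>c. c * _"] cong: if_cong)
  also have "\<dots> = (\<Sum>m\<le>n. \<Sum>j=i..n. \<mu> j * gauss_binomial K (int m) (int j) * A m)"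
    by (intro sum.cong refl) (simp add: inv sum_distrib_right[symmetric])
  also have "\<dots> = (\<Sum>j=i..n. \<Sum>m\<le>n. \<mu> j * gauss_binomial K (int m) (int j) * A m)"
    by (rule sum.swap)
  also have "\<dots> = (\<Sum>j=i..n. \<mu> j * (gauss_binomial K (int n) (int j) * (\<Prod>l=j..<t. 1 + K ^ (n - l) * x)))"
    unfolding sumA[symmetric] sum_distrib_left by (simp add: mult.assoc)
  \<comment> \<open>The subtracted sum is 0 by inversion at \<open>m = n\<close>, since
    \<open>i < n\<close>. It produces the \<open>- 1\<close> of the formula and cancels every term
    with \<open>j \<ge> t\<close>, where the product is empty.\<close>
  also have "\<dots> = \<dots> - (\<Sum>j=i..n. \<mu> j * gauss_binomial K (int n) (int j))"
    using inv[of n] \<open>i < n\<close> by simp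
  also have "\<dots> = (\<Sum>j=i..n. \<mu> j * gauss_binomial K (int n) (int j) * ((\<Prod>l=j..<t. 1 + K ^ (n - l) * x) - 1))"
    unfolding sum_subtractf[symmetric] by (simp add: algebra_simps)
  also have "\<dots> = (\<Sum>j=i..<t. \<mu> j * gauss_binomial K (int n) (int j) * ((\<Prod>l=j..<t. 1 + K ^ (n - l) * x) - 1))"
    using \<open>t \<le> n\<close> by (intro sum.mono_neutral_right) auto
  finally show ?thesis by (simp add: A_def \<mu>_def)
qed

end

section \<open>Counting singular vectors\<close>

text \<open>
  \<open>Z\<close> is the set of singular vectors. The multiplicity \<open>s\<close> is \<open>q\<close> for Hermitian forms over a field
  with \<open>q\<^sup>2\<close> elements, the order of the field for alternating forms, and \<open>1\<close> for quadratic forms.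
\<close>

locale polar_form =
  fixes b :: "'f::{field,finite} ^ 'm \<Rightarrow> 'f ^ 'm \<Rightarrow> 'f" and Z :: "('f ^ 'm) set" and s :: nat
  assumes linear: "linear_functional (\<lambda>u. b u v)"
    and sym: "b u v = 0 \<Longrightarrow> b v u = 0"
    and zero_Z: "0 \<in> Z"
    and scale_Z: "u \<in> Z \<Longrightarrow> c *s u \<in> Z"
    and add_Z: "u \<in> Z \<Longrightarrow> v \<in> Z \<Longrightarrow> b u v = 0 \<Longrightarrow> u + v \<in> Z"
    and isotropic_Z: "u \<in> Z \<Longrightarrow> b u u = 0"
    and nondegenerate_Z: "u \<in> Z \<Longrightarrow> (\<And>v. b v u = 0) \<Longrightarrow> u = 0"
    and card_line: "u \<in> Z \<Longrightarrow> b v u \<noteq> 0 \<Longrightarrow> card {c. v + c *s u \<in> Z} = s"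
begin

text \<open>A common notion for all cases, matched later with \<open>isotropic_subspaces\<close> and
  \<open>singular_subspaces\<close>.\<close>

definition I :: "('f ^ 'm) set set" where
  "I = {U. vec.subspace U \<and> U \<subseteq> Z \<and> (\<forall>u\<in>U. \<forall>v\<in>U. b u v = 0)}"

definition perp :: "('f ^ 'm) set \<Rightarrow> ('f ^ 'm) set" where
  "perp T = {v. \<forall>t\<in>T. b v t = 0}"

definition K :: real where "K = real CARD('f)"

lemma K_gt_1: "K > 1"
  using card_field_gt_1 by (simp add: K_def)

lemma b_add: "b (u + v) w = b u w + b v w"
  using linear[of w] by (simp add: Vector_Spaces.linear_iff)

lemma b_scale: "b (c *s u) w = c * b u w"
  using linear[of w] by (simp add: Vector_Spaces.linear_iff)

lemma b_zero: "b 0 w = 0"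
  using b_scale[of 0 0 w] by simp

lemma I_subspace: "T \<in> I \<Longrightarrow> vec.subspace T"
  by (simp add: I_def)

lemma subspace_perp: "vec.subspace (perp T)"
  by (auto simp: vec.subspace_def perp_def b_add b_scale b_zero)

lemma perp_span_insert:
  assumes T: "vec.subspace T"
  shows "perp (vec.span (insert u T)) = {v \<in> perp T. b v u = 0}"
proof (intro equalityI subsetI)
  fix v assume "v \<in> perp (vec.span (insert u T))"
  then show "v \<in> {v \<in> perp T. b v u = 0}"
    by (auto simp: perp_def intro: vec.span_base)
next
  fix v assume v: "v \<in> {v \<in> perp T. b v u = 0}"
  have "b v (t + c *s u) = 0" if "t \<in> T" for t c
    using v that sym[of v t] sym[of v u] by (intro sym[of _ v]) (auto simp: perp_def b_add b_scale)
  then show "v \<in> perp (vec.span (insert u T))"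
    by (auto simp: perp_def span_insert_explicit[OF T])
qed

lemma span_insert_I:
  assumes T: "T \<in> I" and u: "u \<in> Z" "u \<in> perp T"
  shows "vec.span (insert u T) \<in> I"
proof -
  have bu: "b u t = 0" "b t u = 0" if "t \<in> T" for t using u sym that by (auto simp: perp_def)
  have Z: "t + c *s u \<in> Z" if "t \<in> T" for t c
    using that T bu[of t] u
    by (intro add_Z scale_Z sym[of "c *s u" t]) (auto simp: I_def b_scale)
  have 1: "b t (t' + d *s u) = 0" "b u (t' + d *s u) = 0" if "t \<in> T" "t' \<in> T" for t t' d
    using that T bu isotropic_Z[OF u(1)]
    by (auto intro!: sym[of "t' + d *s u"] simp: b_add b_scale I_def)
  have "b (t + c *s u) (t' + d *s u) = 0" if "t \<in> T" "t' \<in> T" for t t' c d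
    using 1[OF that] by (simp add: b_add b_scale)
  then have "vec.span (insert u T) \<subseteq> Z" "\<forall>v\<in>vec.span (insert u T). \<forall>w\<in>vec.span (insert u T). b v w = 0"
    using Z unfolding span_insert_explicit[OF I_subspace[OF T]] by auto
  then show ?thesis by (simp add: I_def)
qed

lemma downward_I: "U \<in> I \<Longrightarrow> vec.subspace T \<Longrightarrow> T \<subseteq> U \<Longrightarrow> T \<in> I"
  by (auto simp: I_def)

lemma I_subset_perp: "T \<in> I \<Longrightarrow> T \<subseteq> Z \<inter> perp T"
  by (auto simp: I_def perp_def)

text \<open>Double counting of the pairs with \<open>b v t = 0\<close>. A nonzero \<open>t\<close>
  is perpendicular to a hyperplane of vectors by nondegeneracy, and a \<open>v\<close> outside
  \<open>perp T\<close> to a hyperplane of \<open>T\<close>. Linearity is used in the first argument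
  only, so Hermitian forms are covered.\<close>

lemma card_perp:
  assumes T: "T \<in> I"
  shows "real (card (perp T)) * real (card T) = K ^ CARD('m)"
proof -
  define N where "N = K ^ CARD('m)"
  have N: "real CARD('f ^ 'm) = N" by (simp add: N_def K_def card_UNIV_vec)
  have TT: "0 \<in> T" using T by (simp add: I_def vec.subspace_0)
  have 1: "K * real (card {v. b v t = 0}) = (if t = 0 then K * N else N)" if "t \<in> T" for t
  proof (cases "t = 0")
    case True
    then have "{v. b v t = 0} = UNIV" using b_zero sym by auto
    with True show ?thesis by (simp add: N_def K_def card_UNIV_vec)
  next
    case False
    have "t \<in> Z" using that T by (auto simp: I_def)
    then obtain v where "b v t \<noteq> 0" using nondegenerate_Z[of t] False by blast
    from card_kernel[OF linear _ _ this, of UNIV] False show ?thesis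
      by (simp add: K_def flip: N)
  qed
  have 2: "K * real (card {t\<in>T. b v t = 0}) = (if v \<in> perp T then K * real (card T) else real (card T))" for v
  proof (cases "v \<in> perp T")
    case True
    then have "{t\<in>T. b v t = 0} = T" by (auto simp: perp_def)
    with True show ?thesis by simp
  next
    case False
    then obtain t where t: "t \<in> T" "b t v \<noteq> 0" using sym by (auto simp: perp_def)
    have "{t\<in>T. b v t = 0} = {t\<in>T. b t v = 0}" using sym by auto
    with card_kernel[OF linear I_subspace[OF T] t] False show ?thesis by (simp add: K_def)
  qed
  have "K * N + real (card (T - {0})) * N = (\<Sum>t\<in>T. if t = 0 then K * N else N)"
    using TT by (simp add: sum.remove[of T 0])
  also have "\<dots> = K * (\<Sum>t\<in>T. real (card {v\<in>UNIV. b v t = 0}))"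
    by (simp add: sum_distrib_left 1)
  also have "\<dots> = K * (\<Sum>v\<in>UNIV. real (card {t\<in>T. b v t = 0}))"
    using double_count[of T UNIV "\<lambda>t v. b v t = 0"] by (simp flip: of_nat_sum)
  also have "\<dots> = (\<Sum>v\<in>UNIV. real (card T) + (if v \<in> perp T then (K - 1) * real (card T) else 0))"
    unfolding sum_distrib_left 2 by (intro sum.cong refl) (simp add: algebra_simps)
  also have "\<dots> = N * real (card T) + real (card (perp T)) * ((K - 1) * real (card T))"
    unfolding sum.distrib using N by (simp add: sum.If_cases)
  finally have "(K - 1) * N = (K - 1) * (real (card (perp T)) * real (card T))"
    using TT card_Suc_Diff1[of T 0] by (simp add: algebra_simps of_nat_diff)
  then show ?thesis using K_gt_1 by (simp add: N_def)
qed

text \<open>Outside \<open>u\<^sup>\<bottom>\<close> every line in direction \<open>u\<close> carries exactly \<open>s\<close> singular vectors.\<close>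

lemma card_singular_step:
  assumes T: "T \<in> I" and u: "u \<in> Z" "u \<in> perp T"
  defines "T' \<equiv> vec.span (insert u T)"
  shows "K * (real (card (Z \<inter> perp T)) - real (card (Z \<inter> perp T'))) =
         real s * (real (card (perp T)) - real (card (perp T')))"
proof -
  define W where "W = perp T - perp T'"
  have T': "perp T' = {v \<in> perp T. b v u = 0}"
    using perp_span_insert[OF I_subspace[OF T]] by (simp add: T'_def)
  have W: "v + c *s u \<in> W" if "v \<in> W" for v c
    using that subspace_perp[of T] u isotropic_Z[OF u(1)]
    by (auto simp: W_def T' b_add b_scale vec.subspace_add vec.subspace_scale)
  \<comment> \<open>Pairs of a point and a scalar are counted twice: each point of \<open>W\<close>
    has \<open>s\<close> good scalars, while for each scalar the translation by
    \<open>c *s u\<close> permutes \<open>W\<close>.\<close>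
  have "(\<Sum>v\<in>W. card {c\<in>UNIV. v + c *s u \<in> Z}) = (\<Sum>c\<in>UNIV. card {v\<in>W. v + c *s u \<in> Z})"
    by (rule double_count) simp_all
  also have "(\<Sum>v\<in>W. card {c\<in>UNIV. v + c *s u \<in> Z}) = (\<Sum>v\<in>W. s)"
    using u by (intro sum.cong refl) (auto simp: W_def T' card_line)
  also have "(\<Sum>c\<in>UNIV. card {v\<in>W. v + c *s u \<in> Z}) = (\<Sum>c\<in>(UNIV::'f set). card (Z \<inter> W))"
  proof (intro sum.cong refl)
    fix c :: 'f
    show "card {v\<in>W. v + c *s u \<in> Z} = card (Z \<inter> W)"
    proof (rule bij_betw_same_card[of "\<lambda>v. v + c *s u"], rule bij_betwI[of _ _ _ "\<lambda>v. v + (- c) *s u"])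
      show "(\<lambda>v. v + (- c) *s u) \<in> Z \<inter> W \<rightarrow> {v\<in>W. v + c *s u \<in> Z}"
        using W[of _ "- c"] by auto
    qed (use W in auto)
  qed
  finally have eq: "real s * real (card W) = K * real (card (Z \<inter> W))"
    by (simp add: K_def mult.commute flip: of_nat_mult)
  have "card W = card (perp T) - card (perp T')" "card (perp T') \<le> card (perp T)"
    unfolding W_def by (auto intro!: card_Diff_subset card_mono simp: T')
  moreover have "Z \<inter> W = Z \<inter> perp T - Z \<inter> perp T'" by (auto simp: W_def)
  then have "card (Z \<inter> W) = card (Z \<inter> perp T) - card (Z \<inter> perp T')"
      "card (Z \<inter> perp T') \<le> card (Z \<inter> perp T)"
    by (auto intro!: card_Diff_subset card_mono simp: T')
  ultimately show ?thesis using eq by (simp add: of_nat_diff)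
qed

text \<open>The single steps telescope along a chain of subspaces from \<open>{0}\<close> to
  \<open>T\<close>.\<close>

lemma card_singular_perp:
  assumes "T \<in> I"
  shows "K * (real (card Z) - real (card (Z \<inter> perp T))) = real s * (K ^ CARD('m) - real (card (perp T)))"
  using assms
proof (induction "vec.dim T" arbitrary: T)
  case 0
  then have "T = {0}" using vec.subspace_0[of T] vec.dim_eq_0[of T] by (auto simp: I_def)
  then have "perp T = UNIV" using b_zero sym by (auto simp: perp_def)
  then show ?case by (simp add: card_UNIV_vec K_def)
next
  case (Suc k)
  obtain T0 u where T0: "vec.subspace T0" "vec.dim T0 = k" "T0 \<subseteq> T" "u \<in> T" "vec.span (insert u T0) = T"
    using subspace_split[of T k] Suc by (metis I_subspace)
  have "T0 \<in> I" using downward_I[OF Suc.prems T0(1,3)] .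
  moreover have "u \<in> Z" "u \<in> perp T0" using Suc.prems T0 by (auto simp: I_def perp_def)
  ultimately show ?case
    using card_singular_step[of T0 u] Suc.hyps(1)[of T0] T0
    by (simp add: algebra_simps)
qed

section \<open>Generators and the count of totally isotropic extensions\<close>

text \<open>A further singular vector perpendicular to \<open>G\<close> could be adjoined to
  \<open>G\<close>, against maximality.\<close>

lemma generator_perp:
  assumes "G \<in> generators I"
  shows "Z \<inter> perp G = G"
proof
  show "Z \<inter> perp G \<subseteq> G"
  proof
    fix u assume "u \<in> Z \<inter> perp G"
    then have "vec.span (insert u G) \<in> I" using assms by (intro span_insert_I) (auto simp: generators_def)
    moreover have "G \<subseteq> vec.span (insert u G)" "u \<in> vec.span (insert u G)" by (auto intro: vec.span_base)
    ultimately show "u \<in> G" using assms by (auto simp: generators_def)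
  qed
  show "G \<subseteq> Z \<inter> perp G" using assms I_subset_perp by (auto simp: generators_def)
qed

lemma generator_exists: obtains G where "G \<in> generators I"
proof -
  have "{0} \<in> I" using zero_Z b_zero by (simp add: I_def)
  then obtain G where "G \<in> I" "\<forall>W\<in>I. G \<subseteq> W \<longrightarrow> G = W"
    using finite_has_maximal2[of I "{0}"] by auto
  then show ?thesis using that[of G] by (auto simp: generators_def)
qed

lemma card_I: "T \<in> I \<Longrightarrow> real (card T) = K ^ vec.dim T"
  by (simp add: card_subspace I_subspace K_def)

lemma dim_perp:
  assumes T: "T \<in> I"
  shows "vec.dim (perp T) + vec.dim T = CARD('m)"
proof -
  have "K ^ (vec.dim (perp T) + vec.dim T) = K ^ CARD('m)"
    using card_perp[OF T] card_I[OF T] card_subspace[OF subspace_perp, of T] by (simp add: K_def power_add)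
  then show ?thesis using K_gt_1 by simp
qed

lemma dim_I_le: "T \<in> I \<Longrightarrow> 2 * vec.dim T \<le> CARD('m)"
  using dim_perp[of T] vec.dim_subset[of T "perp T"] I_subset_perp[of T] by auto

lemma dim_kernel_perp:
  assumes "vec.subspace W"
  shows "vec.dim W \<le> Suc (vec.dim {w\<in>W. b w v = 0})"
proof -
  let ?W = "{w\<in>W. b w v = 0}"
  have W: "vec.subspace ?W" using assms by (auto simp: vec.subspace_def b_add b_scale b_zero)
  show ?thesis
  proof (cases "\<exists>w\<in>W. b w v \<noteq> 0")
    case True
    then obtain w where "w \<in> W" "b w v \<noteq> 0" by blast
    from card_kernel[OF linear assms this]
    have "CARD('f) ^ vec.dim W = CARD('f) ^ Suc (vec.dim ?W)"
      using card_subspace[OF W] card_subspace[OF assms] by simp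
    then show ?thesis using card_field_gt_1[where ?'f='f] power_inject_exp[of "CARD('f)"] by (simp del: power_Suc)
  next
    case False
    then have "?W = W" by blast
    then show ?thesis by simp
  qed
qed

text \<open>For generators, \<open>card_singular_perp\<close> says that
  \<open>K * card G - s * card (perp G)\<close> takes one fixed value, whereas a larger dimension
  would increase it strictly.\<close>

lemma generators_dim_le:
  assumes s: "s > 0" and G: "G \<in> generators I" and H: "H \<in> generators I"
  shows "vec.dim G \<le> vec.dim H"
proof (rule ccontr)
  assume less: "\<not> vec.dim G \<le> vec.dim H"
  have I: "G \<in> I" "H \<in> I" using assms by (auto simp: generators_def)
  have "vec.dim (perp G) < vec.dim (perp H)" using dim_perp[OF I(1)] dim_perp[OF I(2)] less by simp
  then have "K ^ vec.dim (perp G) < K ^ vec.dim (perp H)" "K ^ vec.dim H < K ^ vec.dim G"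
    using K_gt_1 less by (simp_all add: not_le)
  then have "real s * real (card (perp G)) < real s * real (card (perp H))"
      "K * real (card H) < K * real (card G)"
    using K_gt_1 s card_I I card_subspace[OF subspace_perp] by (simp_all add: K_def)
  moreover have "K * (real (card Z) - real (card G)) = real s * (K ^ CARD('m) - real (card (perp G)))"
    "K * (real (card Z) - real (card H)) = real s * (K ^ CARD('m) - real (card (perp H)))"
    using card_singular_perp[OF I(1)] card_singular_perp[OF I(2)] generator_perp[OF G] generator_perp[OF H]
    by simp_all
  ultimately show False by (simp add: algebra_simps)
qed

text \<open>The equation for \<open>s\<close> identifies \<open>x\<close> with \<open>p^e\<close> in
  each case. Extensions of \<open>T\<close> are spanned by singular vectors of
  \<open>perp T\<close>, whose number follows by comparing \<open>T\<close> with the generator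
  \<open>G\<close>.\<close>

lemma polar_family_I:
  assumes s: "real s * K ^ CARD('m) = x * K ^ (2 * n + 1)" and s0: "s > 0"
    and G: "G \<in> generators I" "vec.dim G = n"
  shows "polar_family I n x K"
proof
  have GI: "G \<in> I" using G by (simp add: generators_def)
  show "K = real CARD('f)" by (simp add: K_def)
  show "{0} \<in> I" using zero_Z b_zero by (simp add: I_def)
  show "vec.subspace U" if "U \<in> I" for U using that by (rule I_subspace)
  show "T \<in> I" if "U \<in> I" "vec.subspace T" "T \<subseteq> U" for U T using that by (rule downward_I)
  show "vec.dim U = n" if "U \<in> generators I" for U
    using generators_dim_le[OF s0 that G(1)] generators_dim_le[OF s0 G(1) that] G(2) by simp
  fix T assume T: "T \<in> I" and j: "vec.dim T < n"
  define j where "j = vec.dim T"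
  define y where "y = K ^ (n - j)"
  have Kj: "K ^ j > 0" using K_gt_1 by simp
  have n: "K ^ n = K ^ j * y" using j by (simp add: y_def j_def flip: power_add)
  let ?E = "{A \<in> I. T \<subseteq> A \<and> vec.dim A = Suc (vec.dim T)}"
  have E: "?E = {A. vec.subspace A \<and> T \<subseteq> A \<and> A \<subseteq> Z \<inter> perp T \<and> vec.dim A = Suc j}"
  proof (intro equalityI subsetI)
    fix A assume A: "A \<in> {A. vec.subspace A \<and> T \<subseteq> A \<and> A \<subseteq> Z \<inter> perp T \<and> vec.dim A = Suc j}"
    then have "A \<noteq> T" by (auto simp: j_def)
    then obtain u where "u \<in> A" "u \<notin> T" using A by blast
    moreover then have "vec.span (insert u T) = A"
      using A I_subspace[OF T] by (intro span_insert_eq) (auto simp: j_def)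
    ultimately show "A \<in> ?E" using A span_insert_I[OF T, of u] by (auto simp: j_def)
  qed (auto simp: I_def perp_def j_def)
  have "real (card ?E) * (K ^ Suc j - K ^ j) = real (card (Z \<inter> perp T)) - K ^ j"
    unfolding E j_def K_def
  proof (rule card_one_step_extensions)
    show "vec.span (insert v T) \<subseteq> Z \<inter> perp T" if "v \<in> Z \<inter> perp T" for v
      using span_insert_I[OF T, of v] that I_subset_perp[of "vec.span (insert v T)"]
        perp_span_insert[OF I_subspace[OF T], of v] by auto
  qed (use T I_subspace I_subset_perp in auto)
  moreover have "real (card (Z \<inter> perp T)) = K ^ j * (y + x * y\<^sup>2 - x * y)"
  proof -
    define d where "d = K ^ CARD('m)"
    have pT: "real (card (perp T)) * K ^ j = d" using card_perp[OF T] card_I[OF T] by (simp add: j_def d_def)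
    have pG: "real (card (perp G)) * (K ^ j * y) = d" using card_perp[OF GI] card_I[OF GI] G n by (simp add: d_def)
    have sd: "real s * d = K * (x * (K ^ j * y)\<^sup>2)"
      using s by (simp add: d_def power_even_eq flip: n)
    have y0: "y > 0" using K_gt_1 by (simp add: y_def)
    \<comment> \<open>Subtracting the instances of \<open>card_singular_perp\<close> for
      \<open>T\<close> and \<open>G\<close> eliminates the unknown number of singular
      vectors.\<close>
    have "K * (real (card (Z \<inter> perp T)) - K ^ j * y) = real s * (real (card (perp T)) - real (card (perp G)))"
      using card_singular_perp[OF T] card_singular_perp[OF GI] generator_perp[OF G(1)] card_I[OF GI] G n
      by (simp add: algebra_simps)
    from arg_cong[OF this, of "\<lambda>z. (K ^ j * y) * z"]
    have "K * (K ^ j * y) * (real (card (Z \<inter> perp T)) - K ^ j * y) =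
       real s * (y * (real (card (perp T)) * K ^ j) - real (card (perp G)) * (K ^ j * y))"
      by (simp add: algebra_simps)
    also have "\<dots> = real s * d * (y - 1)" unfolding pT pG by (simp add: algebra_simps)
    also have "\<dots> = K * (K ^ j * y) * ((x * (K ^ j * y)) * (y - 1))" unfolding sd by (simp add: power2_eq_square)
    finally have "real (card (Z \<inter> perp T)) - K ^ j * y = x * (K ^ j * y) * (y - 1)"
      using Kj y0 K_gt_1 by simp
    then show ?thesis by (simp add: algebra_simps power2_eq_square)
  qed
  \<comment> \<open>This is the factorisation of \<open>y - 1 + x * y^2 - x * y\<close>.\<close>
  ultimately have "K ^ j * (real (card ?E) * (K - 1)) = K ^ j * ((y - 1) * (1 + y * x))"
    using Kj by (simp add: algebra_simps power2_eq_square)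
  then have "real (card ?E) * (K - 1) = (y - 1) * (1 + y * x)" using K_gt_1 by simp
  then show "real (card ?E) = (K ^ (n - vec.dim T) - 1) / (K - 1) * (1 + K ^ (n - vec.dim T) * x)"
    using K_gt_1 by (simp add: y_def j_def eq_divide_eq)
qed

end

section \<open>Equations over finite fields\<close>

text \<open>Sylow's theorem provides an additive subgroup \<open>H\<close> of order
  \<open>l\<close>. Translation by \<open>g\<close> in \<open>H\<close> permutes \<open>H\<close>,
  and comparing the sums of the elements gives \<open>of_nat l * g = 0\<close>.\<close>

lemma prime_dvd_card_field:
  assumes l: "prime l" "l dvd CARD('f::{field,finite})"
  shows "l = CHAR('f)"
proof -
  define G where "G = \<lparr> carrier = (UNIV :: 'f set), monoid.mult = (+), one = (0 :: 'f) \<rparr>"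
  interpret G: group G
  proof (rule groupI)
    fix x assume "x \<in> carrier G"
    show "\<exists>y\<in>carrier G. y \<otimes>\<^bsub>G\<^esub> x = \<one>\<^bsub>G\<^esub>"
      by (intro bexI[of _ "-x"]) (auto simp: G_def)
  qed (auto simp: G_def add_ac)
  obtain m where "CARD('f) = l * m" using l by auto
  then have "Coset.order G = l ^ 1 * m" by (simp add: Coset.order_def G_def)
  from sylow_thm[OF l(1) G.group_axioms this] obtain H where H: "subgroup H G" "card H = l"
    by (auto simp: G_def)
  have "H \<noteq> {0}" using H l prime_gt_1_nat by fastforce
  moreover have "0 \<in> H" using subgroup.one_closed[OF H(1)] by (simp add: G_def)
  ultimately obtain g where g: "g \<in> H" "g \<noteq> 0" by blast
  have H_add: "g + h \<in> H" if "h \<in> H" for h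
    using subgroup.m_closed[OF H(1) g(1) that] by (simp add: G_def)
  have "finite H" by simp
  then have "(\<lambda>h. g + h) ` H = H"
    by (intro card_subset_eq) (auto simp: card_image H_add)
  then have "\<Sum>H = (\<Sum>h\<in>H. g + h)"
    using sum.reindex[of "\<lambda>h. g + h" H "\<lambda>h. h"] by simp
  also have "\<dots> = of_nat l * g + \<Sum>H" by (simp add: sum.distrib H)
  finally have "of_nat l * g = 0" by simp
  then have "CHAR('f) dvd l" using g by (simp add: of_nat_eq_0_iff_char_dvd)
  moreover have "prime CHAR('f)" using prime_CHAR_semidom finite_imp_CHAR_pos by (metis finite_code)
  ultimately show ?thesis using l primes_dvd_imp_eq by blast
qed

text \<open>A divisor of the field order has no prime factor other than the characteristic, so
  \<open>q\<close> is a power of it. This covers Hermitian forms, where only \<open>q^2\<close> is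
  given as a field order.\<close>

lemma frobenius_add:
  fixes x y :: "'f::{field,finite}"
  assumes "q dvd CARD('f)"
  shows "(x + y) ^ q = x ^ q + y ^ q"
proof -
  have p: "prime CHAR('f)" using prime_CHAR_semidom finite_imp_CHAR_pos by (metis finite_code)
  have "q \<noteq> 0" using assms by (metis card_0_eq dvd_0_left empty_not_UNIV finite_code)
  then obtain m where m: "q = CHAR('f) ^ multiplicity CHAR('f) q * m" "\<not> CHAR('f) dvd m"
    using p by (metis multiplicity_decompose' not_prime_unit)
  have "m = 1"
  proof (rule ccontr)
    assume "m \<noteq> 1"
    then obtain l where "prime l" "l dvd m" using prime_factor_nat by blast
    moreover from this have "l dvd CARD('f)" using m(1) assms by (metis dvd_mult dvd_trans)
    ultimately show False using prime_dvd_card_field m(2) by blast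
  qed
  then show ?thesis using m(1) freshmans_dream'[OF p] by (metis mult.right_neutral)
qed

text \<open>There are at most \<open>r\<close> fibres of size at most \<open>k\<close>, and
  \<open>r * k\<close> points to distribute, so every bound is attained.\<close>

lemma fibre_card_eq:
  assumes A: "finite A" "f ` A \<subseteq> R" and R: "finite R" "card R \<le> r"
    and le: "\<And>a. a \<in> R \<Longrightarrow> card {c\<in>A. f c = a} \<le> k" and card: "card A = r * k" and a: "a \<in> R"
  shows "card {c\<in>A. f c = a} = k"
proof (rule ccontr)
  assume "\<not> ?thesis"
  then have less: "card {c\<in>A. f c = a} < k" using le[OF a] by simp
  have "card A = (\<Sum>a\<in>R. card {c\<in>A. f c = a})"
    using sum.group[OF A(1) R(1) A(2), of "\<lambda>_. 1::nat"] by simp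
  also have "\<dots> < (\<Sum>a\<in>R. k)" using R a less le by (intro sum_strict_mono_ex1) auto
  also have "\<dots> \<le> r * k" using R by simp
  finally show False using card by simp
qed

lemma card_field_square_ge_2:
  assumes "CARD('f::{field,finite}) = q\<^sup>2"
  shows "q \<ge> 2"
proof -
  have "q\<^sup>2 > 1" using card_field_gt_1[where ?'f='f] unfolding assms by (simp del: of_nat_power)
  then show ?thesis by (cases "q = 0 \<or> q = 1") auto
qed

text \<open>The trace maps into the roots of \<open>a ^ q = a\<close>. These roots and each fibre
  are roots of polynomials of degree \<open>q\<close>, and \<open>q * q\<close> is the order of the
  field, so \<open>fibre_card_eq\<close> applies.\<close>

lemma card_trace_fibre:
  fixes a :: "'f::{field,finite}"
  assumes card: "CARD('f) = q\<^sup>2" and inv: "\<And>c::'f. (c ^ q) ^ q = c" and a: "a ^ q = a"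
  shows "card {c. c + c ^ q = a} = q"
proof -
  note q = card_field_square_ge_2[OF card]
  have deg: "degree (monom (1::'f) q + g) = q" if "degree g < q" for g
    using that by (subst degree_add_eq_left) (auto simp: degree_monom_eq)
  have bound: "card {c::'f. poly (monom 1 q + g) c = 0} \<le> q" if "degree g < q" for g
  proof -
    have "monom 1 q + g \<noteq> 0" using deg[OF that] q by auto
    then show ?thesis using card_poly_roots_bound[of "monom 1 q + g"] deg[OF that] by simp
  qed
  have frob: "(x + y) ^ q = x ^ q + y ^ q" for x y :: 'f
    by (rule frobenius_add) (simp add: card power2_eq_square)
  have "card {c\<in>UNIV. c + c ^ q = a} = q"
  proof (rule fibre_card_eq[where R="{a. a ^ q = a}" and r=q])
    show "(\<lambda>c. c + c ^ q) ` UNIV \<subseteq> {a::'f. a ^ q = a}" by (auto simp: frob inv)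
    have "{a::'f. a ^ q = a} = {c. poly (monom 1 q + [:0, -1:]) c = 0}" by (auto simp: poly_monom)
    then show "card {a::'f. a ^ q = a} \<le> q" using bound[of "[:0, -1:]"] q by simp
    fix a :: 'f
    have "{c\<in>UNIV. c + c ^ q = a} = {c. poly (monom 1 q + [:- a, 1:]) c = 0}"
      by (auto simp: poly_monom algebra_simps)
    then show "card {c\<in>UNIV. c + c ^ q = a} \<le> q" using bound[of "[:- a, 1:]"] q by simp
  qed (use card a in \<open>auto simp: power2_eq_square\<close>)
  then show ?thesis by simp
qed

text \<open>As for the trace, now on nonzero elements: at most \<open>q - 1\<close> values, fibres
  of size at most \<open>q + 1\<close>, and \<open>(q - 1) * (q + 1)\<close> elements
  altogether.\<close>

lemma norm_surj:
  fixes a :: "'f::{field,finite}"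
  assumes card: "CARD('f) = q\<^sup>2" and inv: "\<And>c::'f. (c ^ q) ^ q = c" and a: "a ^ q = a" "a \<noteq> 0"
  obtains c where "c ^ Suc q = a"
proof -
  note q = card_field_square_ge_2[OF card]
  have bound: "card {c::'f. c ^ k = a} \<le> k" if "k > 0" for k a
  proof -
    have d: "degree (monom (1::'f) k + [:-a:]) = k"
      using that by (subst degree_add_eq_left) (auto simp: degree_monom_eq)
    then have "monom (1::'f) k + [:-a:] \<noteq> 0" using that by auto
    moreover have "{c::'f. c ^ k = a} = {c. poly (monom 1 k + [:- a:]) c = 0}" by (auto simp: poly_monom)
    ultimately show ?thesis using card_poly_roots_bound[of "monom 1 k + [:- a:]"] d by simp
  qed
  have "card {c\<in>UNIV - {0}. c ^ Suc q = a} = Suc q"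
  proof (rule fibre_card_eq[where R="{a. a \<noteq> 0 \<and> a ^ q = a}" and r="q - 1"])
    show "(\<lambda>c. c ^ Suc q) ` (UNIV - {0}) \<subseteq> {a::'f. a \<noteq> 0 \<and> a ^ q = a}"
      by (auto simp: power_mult_distrib inv)
    have "x * x ^ (q - 1) = x ^ q" for x :: 'f using q by (simp flip: power_Suc)
    then have "{a::'f. a \<noteq> 0 \<and> a ^ q = a} \<subseteq> {c. c ^ (q - 1) = 1}" by (auto simp: mult_cancel_left2 dest: sym) (metis mult_cancel_left2)
    then have "card {a::'f. a \<noteq> 0 \<and> a ^ q = a} \<le> card {c::'f. c ^ (q - 1) = 1}" by (intro card_mono) auto
    also have "\<dots> \<le> q - 1" using q by (intro bound) auto
    finally show "card {a::'f. a \<noteq> 0 \<and> a ^ q = a} \<le> q - 1" .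
    fix a :: 'f
    have "card {c\<in>UNIV - {0}. c ^ Suc q = a} \<le> card {c. c ^ Suc q = a}" by (intro card_mono) auto
    also have "\<dots> \<le> Suc q" by (intro bound) auto
    finally show "card {c\<in>UNIV - {0}. c ^ Suc q = a} \<le> Suc q" .
    have "(q - 1) * Suc q = q\<^sup>2 - 1" using q by (simp add: diff_mult_distrib power2_eq_square)
    then show "card (UNIV - {0::'f}) = (q - 1) * Suc q" using card by simp
  qed (use a in auto)
  then have "{c\<in>UNIV - {0}. c ^ Suc q = a} \<noteq> {}"
    by (metis card.empty nat.distinct(1))
  then show ?thesis using that by blast
qed

text \<open>More than half of the field elements are squares, so the sets of all
  \<open>a * x^2\<close> and of all \<open>c - b * y^2\<close> must meet.\<close>

lemma sum_two_squares_surj: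
  fixes a b c :: "'f::{field,finite}"
  assumes "a \<noteq> 0" "b \<noteq> 0" "(2::'f) \<noteq> 0"
  obtains x y where "a * x\<^sup>2 + b * y\<^sup>2 = c"
proof -
  let ?R = "range (\<lambda>x::'f. x\<^sup>2)"
  have "card {x::'f. x\<^sup>2 = z} \<le> (if z = 0 then 1 else 2)" for z
  proof (cases "\<exists>x. x\<^sup>2 = z")
    case True
    then obtain x where "x\<^sup>2 = z" ..
    then have "{y. y\<^sup>2 = z} = {x, -x}" by (auto simp: power2_eq_iff)
    then show ?thesis using \<open>x\<^sup>2 = z\<close> card_insert_le_m1[of 2 "{-x}" x] by auto
  qed auto
  note le = this
  have "CARD('f) = (\<Sum>z\<in>?R. card {x::'f. x\<^sup>2 = z})"
    using sum.group[of "UNIV :: 'f set" ?R "\<lambda>x. x\<^sup>2" "\<lambda>_. 1::nat"] by simp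
  also have "\<dots> \<le> (\<Sum>z\<in>?R. if z = 0 then 1 else 2)" by (intro sum_mono le)
  also have "\<dots> = 1 + 2 * card (?R - {0})"
    by (subst sum.remove[of _ 0]) (auto intro: range_eqI[of _ _ 0])
  \<comment> \<open>Strictness comes from 0, which has one square root instead of two.\<close>
  also have "\<dots> < 2 * card ?R"
  proof -
    have "0 \<in> ?R" by (auto intro: range_eqI[of _ _ 0])
    then have "card ?R = Suc (card (?R - {0}))" by (metis card.remove finite_code)
    then show ?thesis by simp
  qed
  finally have big: "CARD('f) < 2 * card ?R" .
  let ?A = "(\<lambda>z. a * z) ` ?R" and ?B = "(\<lambda>z. c - b * z) ` ?R"
  have "card ?A = card ?R" "card ?B = card ?R" using assms by (auto intro!: card_image inj_onI)
  moreover have "card ?A + card ?B = card (?A \<union> ?B) + card (?A \<inter> ?B)" by (rule card_Un_Int) auto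
  moreover have "card (?A \<union> ?B) \<le> CARD('f)" by (rule card_mono) auto
  ultimately have "card (?A \<inter> ?B) > 0" using big by linarith
  then have "?A \<inter> ?B \<noteq> {}" by (intro notI) simp
  then obtain z where "z \<in> ?A" "z \<in> ?B" by blast
  then obtain x y where "a * x\<^sup>2 = c - b * y\<^sup>2" by (auto simp: image_iff)
  then show ?thesis using that[of x y] by simp
qed

lemma square_surj_char_2:
  fixes a :: "'f::{field,finite}"
  assumes "(2::'f) = 0"
  obtains x where "x\<^sup>2 = a"
proof -
  have "- y = y" for y :: 'f
    using assms by (metis mult_2 mult_zero_left neg_eq_iff_add_eq_0)
  then have "inj (\<lambda>x::'f. x\<^sup>2)" by (auto simp: inj_def power2_eq_iff)
  then have "surj (\<lambda>x::'f. x\<^sup>2)" by (simp add: finite_UNIV_inj_surj)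
  then show ?thesis using that by (metis surjD)
qed

section \<open>The six classical polar spaces\<close>

lemma dim_less_obtains:
  assumes "vec.dim T < vec.dim W"
  obtains w where "w \<in> W" "w \<notin> T"
proof -
  have "\<not> W \<subseteq> T" using assms vec.dim_subset[of W T] by auto
  then show ?thesis using that by blast
qed

section \<open>Hermitian forms\<close>

lemma hermitian_linear: "hermitian_form q h \<Longrightarrow> linear_functional (\<lambda>u. h u v)"
  unfolding hermitian_form_def by (drule conjunct1, erule spec)

lemma hermitian_swap: "hermitian_form q h \<Longrightarrow> h v u = h u v ^ q"
  unfolding hermitian_form_def by (drule conjunct2, drule spec, erule spec)

text \<open>A nondegenerate form takes every value \<open>c\<close>, and swapping the arguments
  twice raises this value to the power \<open>q\<close> twice.\<close>

lemma hermitian_involution: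
  fixes h :: "'f::{field,finite} ^ 'm \<Rightarrow> 'f ^ 'm \<Rightarrow> 'f" and c :: 'f
  assumes h: "hermitian_form q h" and nd: "nondegenerate h"
  shows "(c ^ q) ^ q = c"
proof -
  obtain u :: "'f ^ 'm" where "u \<noteq> 0" using zero_neq_one by metis
  then obtain v where v: "h u v \<noteq> 0" using nd by (auto simp: nondegenerate_def)
  define w where "w = (c / h u v) *s u"
  have "h w v = c"
    using hermitian_linear[OF h, of v] v by (simp add: Vector_Spaces.linear_iff w_def)
  then show ?thesis using hermitian_swap[OF h, of v w] hermitian_swap[OF h, of w v] by metis
qed

text \<open>Along a line in direction \<open>u\<close> the form changes by the trace of
  \<open>c * h u v\<close>, so the singular points correspond to a trace fibre of size
  \<open>q\<close>.\<close>

lemma polar_form_hermitian: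
  fixes h :: "'f::{field,finite} ^ 'm \<Rightarrow> 'f ^ 'm \<Rightarrow> 'f"
  assumes card: "CARD('f) = q\<^sup>2" and h: "hermitian_form q h" and nd: "nondegenerate h"
  shows "polar_form h {v. h v v = 0} q"
proof -
  have q: "q > 0" using card_field_square_ge_2[OF card] by simp
  note inv = hermitian_involution[OF h nd]
  note lin = hermitian_linear[OF h]
  have swap: "h v u = h u v ^ q" for u v by (rule hermitian_swap[OF h])
  have sym0: "h v u = 0" if "h u v = 0" for u v using swap[of v u] that q by simp
  have add: "h (u + v) w = h u w + h v w" and scale: "h (c *s u) w = c * h u w" for u v w c
    using lin by (simp_all add: Vector_Spaces.linear_iff)
  have zero: "h 0 w = 0" for w using scale[of 0 0 w] by simp
  have frob: "(x + y) ^ q = x ^ q + y ^ q" for x y :: 'f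
    by (rule frobenius_add) (simp add: card power2_eq_square)
  have uminus: "(- x) ^ q = - (x ^ q)" for x :: 'f
    using frob[of x "- x"] q by (simp add: eq_neg_iff_add_eq_0 add.commute zero_power)
  have add2: "h w (u + v) = h w u + h w v" for u v w
    using swap[of w "u + v"] swap[of w u] swap[of w v] by (simp add: add frob)
  have scale2: "h w (c *s u) = c ^ q * h w u" for c u w
    using swap[of w "c *s u"] swap[of w u] by (simp add: scale power_mult_distrib)
  show ?thesis
  proof (rule polar_form.intro)
    show "linear_functional (\<lambda>u. h u v)" for v by (rule lin)
    show "h v u = 0" if "h u v = 0" for u v using that by (rule sym0)
    show "0 \<in> {v. h v v = 0}" by (simp add: zero)
    show "c *s u \<in> {v. h v v = 0}" if "u \<in> {v. h v v = 0}" for u c using that by (simp add: scale scale2)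
    show "u + v \<in> {v. h v v = 0}" if "u \<in> {v. h v v = 0}" "v \<in> {v. h v v = 0}" "h u v = 0" for u v
      using that sym0[of u v] by (simp add: add add2)
    show "h u u = 0" if "u \<in> {v. h v v = 0}" for u using that by simp
    show "u = 0" if "u \<in> {v. h v v = 0}" "\<And>v. h v u = 0" for u
      using nd sym0[OF that(2)] by (simp add: nondegenerate_def)
    fix u v assume u: "u \<in> {v. h v v = 0}" and vu: "h v u \<noteq> 0"
    then have uv: "h u v \<noteq> 0" using sym0 by blast
    have eq: "h (v + c *s u) (v + c *s u) = h v v + (c * h u v + (c * h u v) ^ q)" for c
      using u swap[of v u] by (simp add: add add2 scale scale2 power_mult_distrib)
    have "bij_betw (\<lambda>c. c * h u v) {c. v + c *s u \<in> {v. h v v = 0}} {d. d + d ^ q = - h v v}"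
      using uv by (intro bij_betwI[of _ _ _ "\<lambda>d. d / h u v"])
        (auto simp: eq eq_neg_iff_add_eq_0 add.commute)
    then have "card {c. v + c *s u \<in> {v. h v v = 0}} = card {d. d + d ^ q = - h v v}"
      by (rule bij_betw_same_card)
    also have "\<dots> = q"
      by (intro card_trace_fibre[OF card inv]) (simp add: uminus swap[symmetric])
    finally show "card {c. v + c *s u \<in> {v. h v v = 0}} = q" .
  qed
qed

text \<open>Otherwise \<open>perp G\<close> exceeds \<open>G\<close> by at least two dimensions and
  contains perpendicular \<open>v\<close> and \<open>w\<close> outside \<open>G\<close>.
  Surjectivity of the norm yields a singular \<open>z = c *s v + w\<close>. It lies in
  \<open>G\<close>, hence is perpendicular to \<open>w\<close>, although
  \<open>h z w = h w w\<close> is nonzero.\<close>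

lemma hermitian_generator_dim:
  fixes h :: "'f::{field,finite} ^ 'm \<Rightarrow> 'f ^ 'm \<Rightarrow> 'f"
  assumes card: "CARD('f) = q\<^sup>2" and h: "hermitian_form q h" and nd: "nondegenerate h"
    and G: "G \<in> generators (polar_form.I h {v. h v v = 0})"
  shows "CARD('m) \<le> 2 * vec.dim G + 1"
proof (rule ccontr)
  interpret polar_form h "{v. h v v = 0}" q by (rule polar_form_hermitian[OF card h nd])
  assume "\<not> ?thesis"
  moreover have GI: "G \<in> I" using G by (simp add: generators_def)
  ultimately have dim: "vec.dim G + 2 \<le> vec.dim (perp G)" using dim_perp[OF GI] by simp
  have q: "q > 0" using card_field_square_ge_2[OF card] by simp
  have swap: "h v u = h u v ^ q" for u v by (rule hermitian_swap[OF h])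
  have diag: "h v v ^ q = h v v" for v by (rule swap[symmetric])
  have aniso: "h v v \<noteq> 0" if "v \<in> perp G" "v \<notin> G" for v using that generator_perp[OF G] by blast
  have uminus: "(- x) ^ q = - (x ^ q)" for x :: 'f
    using frobenius_add[of q x "- x"] q by (simp add: eq_neg_iff_add_eq_0 add.commute zero_power card power2_eq_square)
  obtain v where v: "v \<in> perp G" "v \<notin> G"
    using dim_less_obtains[of G "perp G"] dim by auto
  let ?W = "{w \<in> perp G. h w v = 0}"
  obtain w where w: "w \<in> ?W" "w \<notin> G"
    using dim_less_obtains[of G ?W] dim dim_kernel_perp[OF subspace_perp, of G v] by auto
  have vv: "h v v \<noteq> 0" and ww: "h w w \<noteq> 0" using v w aniso by auto
  have "(- (h w w / h v v)) ^ q = - (h w w / h v v)"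
    by (simp add: uminus power_divide diag)
  then obtain c where c: "c ^ Suc q = - (h w w / h v v)"
    using norm_surj[OF card hermitian_involution[OF h nd], of "- (h w w / h v v)"] vv ww by auto
  define z where "z = c *s v + w"
  have wv: "h w v = 0" "h v w = 0" using w sym[of w v] by auto
  have zv: "h z v = c * h v v" and zw: "h z w = h w w" by (simp_all add: z_def b_add b_scale wv)
  have "h z z = c * h v z + h w z" using b_add[of "c *s v" w z] by (simp add: b_scale z_def)
  also have "h v z = c ^ q * h v v" using swap[of v z] by (simp add: zv power_mult_distrib diag)
  also have "h w z = h w w" using swap[of w z] by (simp add: zw diag)
  also have "c * (c ^ q * h v v) + h w w = 0" using c vv by (simp flip: mult.assoc)
  finally have "z \<in> {v. h v v = 0} \<inter> perp G"
    using v w subspace_perp[of G] by (auto simp: z_def vec.subspace_add vec.subspace_scale)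
  then have "z \<in> G" using generator_perp[OF G] by simp
  then have "h w z = 0" using w by (simp add: perp_def)
  then show False using sym[of w z] zw ww by simp
qed

lemma isotropic_subspaces_eq_I:
  assumes "polar_form b {v. b v v = 0} s"
  shows "isotropic_subspaces b = polar_form.I b {v. b v v = 0}"
  unfolding isotropic_subspaces_def polar_form.I_def[OF assms] by blast

section \<open>Alternating forms\<close>

lemma polar_form_alternating:
  fixes b :: "'f::{field,finite} ^ 'm \<Rightarrow> 'f ^ 'm \<Rightarrow> 'f"
  assumes alt: "alternating_form b" and nd: "nondegenerate b"
  shows "polar_form b {v. b v v = 0} CARD('f)"
proof -
  have lin: "linear_functional (\<lambda>u. b u v)" "linear_functional (\<lambda>v. b u v)" and bvv: "b v v = 0" for u v
    using alt by (simp_all add: alternating_form_def bilinear_form_def)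
  have add: "b (u + v) w = b u w + b v w" "b w (u + v) = b w u + b w v" for u v w
    using lin by (simp_all add: Vector_Spaces.linear_iff)
  have skew: "b u v = - b v u" for u v
  proof -
    have "b (u + v) (u + v) = b u v + b v u" unfolding add by (simp add: bvv)
    then show ?thesis by (simp add: bvv eq_neg_iff_add_eq_0)
  qed
  have "b v u = 0" if "b u v = 0" for u v using skew[of v u] that by simp
  then show ?thesis
    using lin(1) nd by (intro polar_form.intro) (simp_all add: bvv nondegenerate_def)
qed

section \<open>Quadratic forms\<close>

lemma polarization_self: "quadratic_form Q \<Longrightarrow> polarization Q u u = 2 * Q u"
proof -
  assume Q: "quadratic_form Q"
  have "u + u = 2 *s u" by (simp add: vec_eq_iff)
  then have "Q (u + u) = 2\<^sup>2 * Q u" using Q by (metis quadratic_form_def)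
  then show ?thesis by (simp add: polarization_def)
qed

text \<open>Along a line in a singular direction \<open>Q\<close> is affine in the parameter, with
  nonzero slope, so it has exactly one zero.\<close>

lemma polar_form_quadratic:
  fixes Q :: "'f::{field,finite} ^ 'm \<Rightarrow> 'f"
  assumes Q: "quadratic_form Q" and nd: "nondegenerate_quadratic Q"
  shows "polar_form (polarization Q) {v. Q v = 0} 1"
proof (rule polar_form.intro)
  let ?b = "polarization Q"
  have comm: "?b u v = ?b v u" for u v by (simp add: polarization_def add.commute)
  have lin: "linear_functional (\<lambda>u. ?b u v)" "linear_functional (\<lambda>v. ?b u v)" for u v
    using Q by (simp_all add: quadratic_form_def bilinear_form_def)
  have hom: "Q (c *s v) = c\<^sup>2 * Q v" for c v using Q by (simp add: quadratic_form_def)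
  have Qadd: "Q (u + v) = Q u + Q v + ?b u v" for u v by (simp add: polarization_def)
  show "linear_functional (\<lambda>u. ?b u v)" for v by (rule lin)
  show "?b v u = 0" if "?b u v = 0" for u v using that comm by simp
  show "0 \<in> {v. Q v = 0}" using hom[of 0 0] by simp
  show "c *s u \<in> {v. Q v = 0}" if "u \<in> {v. Q v = 0}" for u c using that by (simp add: hom)
  show "u + v \<in> {v. Q v = 0}" if "u \<in> {v. Q v = 0}" "v \<in> {v. Q v = 0}" "?b u v = 0" for u v
    using that by (simp add: Qadd)
  show "?b u u = 0" if "u \<in> {v. Q v = 0}" for u
    using that polarization_self[OF Q] by simp
  show "u = 0" if "u \<in> {v. Q v = 0}" "\<And>v. ?b v u = 0" for u
    using nd that comm by (auto simp: nondegenerate_quadratic_def)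
  fix u v assume u: "u \<in> {v. Q v = 0}" and vu: "?b v u \<noteq> 0"
  have "?b v (c *s u) = c * ?b v u" for c using lin(2)[of v] by (simp add: Vector_Spaces.linear_iff)
  then have "Q (v + c *s u) = Q v + c * ?b v u" for c using u by (simp add: Qadd hom)
  moreover have "Q v + c * ?b v u = 0 \<longleftrightarrow> c = (- Q v) / ?b v u" for c
    using vu by (metis add.commute eq_neg_iff_add_eq_0 nonzero_eq_divide_eq)
  ultimately have "{c. v + c *s u \<in> {v. Q v = 0}} = {(- Q v) / ?b v u}" by simp
  then show "card {c. v + c *s u \<in> {v. Q v = 0}} = 1" by simp
qed

lemma singular_subspaces_eq_I:
  assumes "polar_form (polarization Q) {v. Q v = 0} s"
  shows "singular_subspaces Q = polar_form.I (polarization Q) {v. Q v = 0}"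
proof -
  have "polarization Q u v = 0" if "vec.subspace U" "\<forall>u\<in>U. Q u = 0" "u \<in> U" "v \<in> U" for U u v
    using that vec.subspace_add[of U u v] by (simp add: polarization_def)
  then show ?thesis unfolding singular_subspaces_def polar_form.I_def[OF assms] by blast
qed

text \<open>Otherwise \<open>perp G\<close> exceeds \<open>G\<close> by at least three dimensions.
  In characteristic 2 every element is a square, and two perpendicular vectors combine to a singular
  one outside \<open>G\<close>. In other characteristics three of them are combined through
  \<open>sum_two_squares_surj\<close>.\<close>

lemma quadratic_generator_dim:
  fixes Q :: "'f::{field,finite} ^ 'm \<Rightarrow> 'f"
  assumes Q: "quadratic_form Q" and nd: "nondegenerate_quadratic Q"
    and G: "G \<in> generators (polar_form.I (polarization Q) {v. Q v = 0})"
  shows "CARD('m) \<le> 2 * vec.dim G + 2"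
proof (rule ccontr)
  let ?b = "polarization Q"
  interpret polar_form ?b "{v. Q v = 0}" 1 by (rule polar_form_quadratic[OF Q nd])
  have comm: "?b u v = ?b v u" for u v by (simp add: polarization_def add.commute)
  have hom: "Q (c *s v) = c\<^sup>2 * Q v" for c v using Q by (simp add: quadratic_form_def)
  have Qadd: "Q (u + v) = Q u + Q v + ?b u v" for u v by (simp add: polarization_def)
  assume "\<not> ?thesis"
  moreover have GI: "G \<in> I" using G by (simp add: generators_def)
  ultimately have dim: "vec.dim G + 3 \<le> vec.dim (perp G)" using dim_perp[OF GI] by simp
  note GS = I_subspace[OF GI]
  have aniso: "Q v \<noteq> 0" if "v \<in> perp G" "v \<notin> G" for v using that generator_perp[OF G] by blast
  have in_G: "z \<in> G" if "z \<in> perp G" "Q z = 0" for z using that generator_perp[OF G] by blast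
  obtain v where v: "v \<in> perp G" "v \<notin> G"
    using dim_less_obtains[of G "perp G"] dim by auto
  let ?W = "{w \<in> perp G. ?b w v = 0}"
  have W: "vec.subspace ?W" using subspace_perp[of G]
    by (auto simp: vec.subspace_def b_add b_scale b_zero)
  have dimW: "vec.dim G + 2 \<le> vec.dim ?W" using dim dim_kernel_perp[OF subspace_perp, of G v] by simp
  \<comment> \<open>Choosing \<open>w\<close> outside the span of \<open>v\<close> and
    \<open>G\<close> settles characteristic 2, where \<open>?b w w = 0\<close> rules out a
    contradiction through the polarization.\<close>
  have "vec.dim (vec.span (insert v G)) < vec.dim ?W" using dimW v GS by (simp add: dim_insert_subspace)
  then obtain w where w: "w \<in> ?W" "w \<notin> vec.span (insert v G)"
    using dim_less_obtains by blast
  then have wG: "w \<notin> G" by (auto intro: vec.span_base)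
  have scale_v: "?b (c *s v) w = 0" "?b w (c *s v) = 0" for c
    using w comm[of w v] comm[of w "c *s v"] by (auto simp: b_scale)
  show False
  proof (cases "(2::'f) = 0")
    case True
    then obtain c where c: "c\<^sup>2 = - Q w / Q v" using square_surj_char_2 by metis
    have "Q (w + c *s v) = 0"
      using c aniso[OF v] by (simp add: Qadd hom scale_v)
    then have "w + c *s v \<in> G"
      using v w subspace_perp[of G] by (intro in_G) (auto simp: vec.subspace_add vec.subspace_scale)
    then have "w - (- c) *s v \<in> vec.span G" by (simp add: vec.span_base)
    then show False using w(2) unfolding vec.span_breakdown_eq by blast
  next
    case False
    let ?W2 = "{u \<in> ?W. ?b u w = 0}"
    obtain u where u: "u \<in> ?W2" "u \<notin> G"
      using dim_less_obtains[of G ?W2] dimW dim_kernel_perp[OF W, of w] by auto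
    have Q0: "Q v \<noteq> 0" "Q w \<noteq> 0" "Q u \<noteq> 0" using aniso v w u wG by auto
    obtain x y where xy: "Q v * x\<^sup>2 + Q w * y\<^sup>2 = - Q u"
      using sum_two_squares_surj[OF Q0(1,2) False] by metis
    define z where "z = (x *s v + y *s w) + u"
    have vu: "?b v u = 0" "?b w u = 0" using u comm by auto
    have "Q (x *s v + y *s w) = x\<^sup>2 * Q v + y\<^sup>2 * Q w"
      using w comm[of w v] comm[of v "y *s w"] by (simp add: Qadd hom b_scale)
    then have "Q z = 0"
      using xy by (simp add: z_def Qadd b_add b_scale vu mult.commute)
    then have "z \<in> G"
      using v w u subspace_perp[of G] unfolding z_def
      by (intro in_G) (auto simp: vec.subspace_add vec.subspace_scale)
    then have "?b z u = 0" using u comm[of z u] by (auto simp: perp_def)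
    moreover have "?b z u = 2 * Q u" by (simp add: z_def b_add b_scale vu polarization_self[OF Q])
    ultimately show False using Q0 False by simp
  qed
qed

text \<open>A singular subspace of largest dimension is maximal under inclusion.\<close>

lemma witt_index_generator:
  fixes Q :: "'f::{field,finite} ^ 'm \<Rightarrow> 'f"
  assumes "quadratic_form Q"
  obtains G where "G \<in> generators (singular_subspaces Q)" "vec.dim G = witt_index Q"
proof -
  let ?D = "vec.dim ` singular_subspaces Q"
  have "Q (0 *s 0) = 0\<^sup>2 * Q 0" using assms by (metis quadratic_form_def)
  then have "{0} \<in> singular_subspaces Q" by (simp add: singular_subspaces_def)
  then have "Max ?D \<in> ?D" by (intro Max_in) auto
  then obtain G where G: "G \<in> singular_subspaces Q" "vec.dim G = witt_index Q"
    by (auto simp: witt_index_def)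
  moreover have "W = G" if "W \<in> singular_subspaces Q" "G \<subseteq> W" for W
  proof -
    have "vec.dim W \<le> Max ?D" using that by (intro Max_ge) auto
    then show ?thesis using that G vec.subspace_dim_equal[of G W]
      by (auto simp: singular_subspaces_def witt_index_def)
  qed
  ultimately show ?thesis using that by (auto simp: generators_def)
qed

section \<open>The parameters of the six families\<close>

text \<open>Each case amounts to finding a generator of dimension \<open>n\<close> and checking
  \<open>s * K ^ CARD('m) = p^e * K ^ (2 * n + 1)\<close>. The dimension comes from the Witt index
  in the hyperbolic and elliptic cases, and from bounds or a self-perpendicular generator in the
  others.\<close>

lemma classical_polar_family:
  fixes S :: "('f::{field,finite} ^ 'm) set set"
  assumes "classical_polar_space n p e S"
  shows "polar_family S n (p powr e) p"
  using assms
proof cases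
  case (polar_2A_odd q h)
  interpret polar_form h "{v. h v v = 0}" q by (rule polar_form_hermitian) fact+
  note q = card_field_square_ge_2[OF polar_2A_odd(4)]
  obtain G where G: "G \<in> generators I" using generator_exists by blast
  then have "2 * vec.dim G \<le> CARD('m)" by (intro dim_I_le) (simp add: generators_def)
  moreover have "CARD('m) \<le> 2 * vec.dim G + 1" by (rule hermitian_generator_dim) fact+
  ultimately have dim: "vec.dim G = n" using polar_2A_odd(5) by simp
  have K: "(real q)\<^sup>2 = K" using polar_2A_odd(4) by (simp add: K_def)
  have "K powr (- 1 / 2) = 1 / real q"
    using q by (simp add: powr_minus_divide powr_half_sqrt flip: K)
  then have "real q * K ^ CARD('m) = K powr (- 1 / 2) * K ^ (2 * n + 1)"
    using q polar_2A_odd(5) by (simp add: field_simps power2_eq_square flip: K)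
  then show ?thesis
    unfolding polar_2A_odd(1-3) isotropic_subspaces_eq_I[OF polar_form_axioms] K
    using q by (intro polar_family_I[OF _ _ G dim]) simp_all
next
  case (polar_2A_even q h)
  interpret polar_form h "{v. h v v = 0}" q by (rule polar_form_hermitian) fact+
  note q = card_field_square_ge_2[OF polar_2A_even(4)]
  obtain G where G: "G \<in> generators I" using generator_exists by blast
  then have "2 * vec.dim G \<le> CARD('m)" by (intro dim_I_le) (simp add: generators_def)
  moreover have "CARD('m) \<le> 2 * vec.dim G + 1" by (rule hermitian_generator_dim) fact+
  ultimately have dim: "vec.dim G = n" using polar_2A_even(5) by simp
  have K: "(real q)\<^sup>2 = K" using polar_2A_even(4) by (simp add: K_def)
  have "K powr (1 / 2) = real q" by (simp add: powr_half_sqrt flip: K)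
  then have "real q * K ^ CARD('m) = K powr (1 / 2) * K ^ (2 * n + 1)"
    using polar_2A_even(5) by simp
  then show ?thesis
    unfolding polar_2A_even(1-3) isotropic_subspaces_eq_I[OF polar_form_axioms] K
    using q by (intro polar_family_I[OF _ _ G dim]) simp_all
next
  case (polar_C q b)
  interpret polar_form b "{v. b v v = 0}" "CARD('f)" by (rule polar_form_alternating) fact+
  obtain G where G: "G \<in> generators I" using generator_exists by blast
  \<comment> \<open>All vectors are singular for an alternating form, so a generator equals its own
    perp and has half the dimension of the space.\<close>
  have "{v. b v v = 0} = UNIV" using polar_C(6) by (auto simp: alternating_form_def)
  then have "perp G = G" using generator_perp[OF G] by simp
  then have dim: "vec.dim G = n" using dim_perp[of G] G polar_C(5) by (simp add: generators_def)
  have K: "real q = K" using polar_C(4) by (simp add: K_def)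
  have "real CARD('f) * K ^ CARD('m) = K powr 0 * K ^ (2 * n + 1)"
    using polar_C(5) K_gt_1 by (simp add: K_def)
  then show ?thesis
    unfolding polar_C(1-3) isotropic_subspaces_eq_I[OF polar_form_axioms] K
    by (intro polar_family_I[OF _ _ G dim]) simp_all
next
  case (polar_D q Q)
  then have Q: "quadratic_form Q" "nondegenerate_quadratic Q" "CARD('m) = 2 * n" "witt_index Q = n"
    by (auto simp: hyperbolic_def)
  interpret polar_form "polarization Q" "{v. Q v = 0}" 1 by (rule polar_form_quadratic[OF Q(1,2)])
  note I = singular_subspaces_eq_I[OF polar_form_axioms]
  obtain G where G: "G \<in> generators I" and dim: "vec.dim G = n"
    using witt_index_generator[OF Q(1)] unfolding I Q(4) .
  have K: "real q = K" using polar_D(4) by (simp add: K_def)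
  have "real 1 * K ^ CARD('m) = K powr (- 1) * K ^ (2 * n + 1)"
    using K_gt_1 Q(3) by (simp add: powr_minus_divide)
  then show ?thesis
    unfolding polar_D(1-3) I K by (intro polar_family_I[OF _ _ G dim]) simp_all
next
  case (polar_B q Q)
  then have Q: "quadratic_form Q" "nondegenerate_quadratic Q" "CARD('m) = 2 * n + 1"
    by (auto simp: parabolic_def)
  interpret polar_form "polarization Q" "{v. Q v = 0}" 1 by (rule polar_form_quadratic[OF Q(1,2)])
  obtain G where G: "G \<in> generators I" using generator_exists by blast
  then have "2 * vec.dim G \<le> CARD('m)" by (intro dim_I_le) (simp add: generators_def)
  then have dim: "vec.dim G = n" using quadratic_generator_dim[OF Q(1,2) G] Q(3) by simp
  have K: "real q = K" using polar_B(4) by (simp add: K_def)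
  have "real 1 * K ^ CARD('m) = K powr 0 * K ^ (2 * n + 1)" using Q(3) K_gt_1 by simp
  then show ?thesis
    unfolding polar_B(1-3) singular_subspaces_eq_I[OF polar_form_axioms] K
    by (intro polar_family_I[OF _ _ G dim]) simp_all
next
  case (polar_2D q Q)
  then have Q: "quadratic_form Q" "nondegenerate_quadratic Q" "CARD('m) = 2 * n + 2" "witt_index Q = n"
    by (auto simp: elliptic_def)
  interpret polar_form "polarization Q" "{v. Q v = 0}" 1 by (rule polar_form_quadratic[OF Q(1,2)])
  note I = singular_subspaces_eq_I[OF polar_form_axioms]
  obtain G where G: "G \<in> generators I" and dim: "vec.dim G = n"
    using witt_index_generator[OF Q(1)] unfolding I Q(4) .
  have K: "real q = K" using polar_2D(4) by (simp add: K_def)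
  have "real 1 * K ^ CARD('m) = K powr 1 * K ^ (2 * n + 1)" using Q(3) K_gt_1 by simp
  then show ?thesis
    unfolding polar_2D(1-3) I K by (intro polar_family_I[OF _ _ G dim]) simp_all
qed

theorem proposition4p1:
  fixes S X Y :: "('f::{field,finite} ^ 'm) set set"
    and p e :: real and n t :: nat
  assumes "classical_polar_space n p e S"
    and "X = generators S"
    and "1 \<le> t" and "t \<le> n"
    and "steiner_system S t Y"
  shows "(\<forall>i<n. inner_distribution n X Y (n - i) =
            (\<Sum>j=i..<t. (-1) ^ (j - i) * p ^ ((j - i) choose 2) *
               gauss_binomial p j i * gauss_binomial p n j *
               ((\<Prod>l=j..<t. 1 + p powr (real n - real l + e)) - 1))) \<and>
         (\<forall>k\<in>{1..t}. dual_distribution p e n X Y k = 0)"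
proof -
  interpret polar_family S n "p powr e" p using assms(1) by (rule classical_polar_family)
  \<comment> \<open>Since \<open>l < t \<le> n\<close>, the natural subtraction \<open>n - l\<close>
    is exact and the real power splits into an integer power and \<open>p powr e\<close>.\<close>
  have prod: "(\<Prod>l=j..<t. 1 + p powr (real n - real l + e)) = (\<Prod>l=j..<t. 1 + p ^ (n - l) * p powr e)" for j
  proof (intro prod.cong refl)
    fix l assume "l \<in> {j..<t}"
    then have "real n - real l = real (n - l)" using \<open>t \<le> n\<close> by simp
    then show "1 + p powr (real n - real l + e) = 1 + p ^ (n - l) * p powr e"
      using K_gt_1 by (metis add.commute less_trans powr_add powr_realpow zero_less_one)
  qed
  show ?thesis
    unfolding prod assms(2) dual_distribution_def
  proof (intro conjI allI impI ballI)
    fix i assume "i < n"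
    then show "inner_distribution n (generators S) Y (n - i) =
        (\<Sum>j=i..<t. (-1) ^ (j - i) * p ^ ((j - i) choose 2) * gauss_binomial p j i *
          gauss_binomial p n j * ((\<Prod>l=j..<t. 1 + p ^ (n - l) * p powr e) - 1))"
      by (rule inner_distribution_formula[OF assms(5,4)])
  next
    fix k assume "k \<in> {1..t}"
    then show "(\<Sum>i=0..n. Q_number p e n (card (generators S)) k i *
        inner_distribution n (generators S) Y i) = 0"
      by (intro dual_distribution_vanishes[OF K_gt_1 assms(4) sum_inner_distribution[OF assms(5,4)]]) auto
  qed
qed

end
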